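(* Let $\eta_i=m_i+\varepsilon_i$, $i=1,\dots,n$, be observations in a real, separable, infinite dimensional Hilbert space $H$ following the signal plus noise model described in the context, let $d\in\mathbb{N}$ and $\gamma\in(0,1/2)$, and let $\hat{\mathscr{C}}=\hat{\mathscr{C}}_n$ be estimates of the long run covariance operator $\mathscr{C}$ which are self-adjoint Hilbert-Schmidt operators. Assume: (i) $\|\mathscr{C}-\hat{\mathscr{C}}\|_{\mathcal S}=o_P(1)$ as $n\to\infty$; (ii) $\lambda_d>\lambda_{d+1}$, where $\lambda_1\ge\lambda_2\ge\dots\ge0$ are the eigenvalues of $\mathscr{C}$; (iii) under $H_0$, $\mathscr{T}^{(d)}\stackrel{\mathscr{D}}{\longrightarrow}\sup_{0\le x\le1}\big(\sum_{1\le r\le d}\mathscr{B}_r^2(x)\big)^{1/2}$ as $n\to\infty$; (iv) $\max_{1\le k<n}\|S_k(\varepsilon)\|=\mathcal{O}_P(1)$ as $n\to\infty$. Then the statistic $\hat{\mathscr{T}}^{(d)\prime}$ based on the change-aligned first principal component $\hat v_1'$ satisfies under $H_0$, as $n\to\infty$, $$\hat{\mathscr{T}}^{(d)\prime}\stackrel{\mathscr{D}}{\longrightarrow}\sup_{0\le x\le1}\Big(\sum_{1\le r\le d}\mathscr{B}_r^2(x)\Big)^{1/2}.$$ Here $\{\mathscr{B}_r(x),x\in[0,1]\}$, $r=1,\dots,d$, are independent standard Brownian bridges.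
   Context: Model. $\eta_i=m_i+\varepsilon_i$ with $m_i=g(i/n)\Delta$, $i=1,\dots,n$, where $\Delta\in H$, $\|\Delta\|=1$, $g:[0,1]\to\mathbb{R}$ is piecewise Lipschitz continuous, and $\{\varepsilon_i\}_{i\in\mathbb{Z}}$ is a centered, strictly stationary $H$-valued time series with $E\|\varepsilon_1\|^2<\infty$. The null hypothesis $H_0$ is that $g$ is constant on $[0,1]$. Operators. $(x\otimes y)z=\langle y,z\rangle x$; $\|\cdot\|_{\mathcal S}$ is the Hilbert-Schmidt norm; $\mathscr{C}_h=E[\varepsilon_0\otimes\varepsilon_h]$ with $\sum_{h\in\mathbb{Z}}\|\mathscr{C}_h\|_{\mathcal S}<\infty$, and $\mathscr{C}=\sum_{h\in\mathbb{Z}}\mathscr{C}_h$. Spectral decompositions: $\mathscr{C}=\sum_j\lambda_j(v_j\otimes v_j)$, $\hat{\mathscr{C}}=\sum_j\hat\lambda_j(\hat v_j\otimes\hat v_j)$, with real eigenvalues in decreasing order ($\lambda_j\ge0$; the $\hat\lambda_j$ are not assumed non-negative) and orthonormal bases $\{v_j\}$, $\{\hat v_j\}$ of $H$. It is assumed that $\lambda_d>0$. Statistics. For a (Hilbert space or $\mathbb{R}^d$ valued) series $x_1,\dots,x_n$ put $S_k(x)=n^{-1/2}\sum_{i=1}^k(x_i-\bar x_n)$, $\bar x_n=n^{-1}\sum_{i=1}^nx_i$. With $|\cdot|$ the Euclidean norm, $\mathscr{T}^{(d)}=\max_{1\le k<n}|\Sigma^{-1/2}S_k(\boldsymbol{\eta})|$,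 where $\boldsymbol{\eta}_i=[\langle\eta_i,v_1\rangle,\dots,\langle\eta_i,v_d\rangle]'$ and $\Sigma=\operatorname{diag}(\lambda_1,\dots,\lambda_d)$. Change-aligned component: $$\hat v_1'=\frac{\hat v_1/n^\gamma+\hat s\hat u}{\|\hat v_1/n^\gamma+\hat s\hat u\|},\qquad \hat u=S_{\hat k}(\eta)/n^{1/2},\quad \hat s=\operatorname{sign}\langle\hat v_1,\hat u\rangle,$$ where $\hat k\in\{1,\dots,n-1\}$ is chosen such that $\|S_{\hat k}(\eta)\|=\max_{1\le k<n}\|S_k(\eta)\|$, and $\operatorname{sign}$ takes values in $\{-1,1\}$ (with $\operatorname{sign}(0):=1$). The adjusted statistic is $$\hat{\mathscr{T}}^{(d)\prime}=\max_{1\le k<n}|\hat\Sigma^{-1/2}S_k(\hat{\boldsymbol{\eta}}')|,\quad \hat{\boldsymbol{\eta}}_i'=[\langle\eta_i,\hat v_1'\rangle,\langle\eta_i,\hat v_2\rangle,\dots,\langle\eta_i,\hat v_d\rangle]',\quad \hat\Sigma=\operatorname{diag}(|\hat\lambda_1|,\dots,|\hat\lambda_d|),$$ with $\hat{\mathscr{T}}^{(d)\prime}:=\infty$ if $\hat\lambda_j=0$ for some $1\le j\le d$. *)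

theory Defs
  imports "HOL-Probability.Probability"
begin

text \<open>
  The Hilbert space is a type of sort \<open>{real_inner, banach, second_countable_topology}\<close>.
  Orthonormal bases and eigenvalue sequences are indexed from \<open>0\<close>, so \<open>v j\<close> and
  \<open>l j\<close> are what is usually written with index \<open>j + 1\<close>.
\<close>

definition infinite_dimensional :: "'h::real_vector itself \<Rightarrow> bool" where
  "infinite_dimensional _ \<longleftrightarrow> \<not> (\<exists>S::'h set. finite S \<and> span S = UNIV)"

definition orthonormal_basis :: "(nat \<Rightarrow> 'h::real_inner) \<Rightarrow> bool" where
  "orthonormal_basis e \<longleftrightarrow>
     (\<forall>i j. e i \<bullet> e j = (if i = j then 1 else 0)) \<and> closure (span (range e)) = UNIV"

lift_definition outer :: "'h::real_inner \<Rightarrow> 'h \<Rightarrow> 'h \<Rightarrow>\<^sub>L 'h" is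
  "\<lambda>x y z. (y \<bullet> z) *\<^sub>R x"
  by (intro bounded_linear_scaleR_const bounded_linear_inner_right)

definition self_adjoint :: "('h::real_inner \<Rightarrow>\<^sub>L 'h) \<Rightarrow> bool" where
  "self_adjoint A \<longleftrightarrow> (\<forall>x y. blinfun_apply A x \<bullet> y = x \<bullet> blinfun_apply A y)"

definition hilbert_schmidt :: "('h::real_inner \<Rightarrow>\<^sub>L 'h) \<Rightarrow> bool" where
  "hilbert_schmidt A \<longleftrightarrow>
     (\<exists>e. orthonormal_basis e \<and> summable (\<lambda>j. (norm (blinfun_apply A (e j)))\<^sup>2))"

text \<open>The value does not depend on the orthonormal basis that is selected; it is meaningful
  for Hilbert-Schmidt operators only.\<close>

definition hs_norm :: "('h::real_inner \<Rightarrow>\<^sub>L 'h) \<Rightarrow> real" where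
  "hs_norm A =
     (let e = (SOME e. orthonormal_basis e) in sqrt (\<Sum>j. (norm (blinfun_apply A (e j)))\<^sup>2))"

text \<open>The series converges in operator norm, which for an orthonormal basis and square summable
  \<open>l\<close> is the same as convergence in Hilbert-Schmidt norm.\<close>

definition spectral_decomposition ::
    "('h::real_inner \<Rightarrow>\<^sub>L 'h) \<Rightarrow> (nat \<Rightarrow> real) \<Rightarrow> (nat \<Rightarrow> 'h) \<Rightarrow> bool" where
  "spectral_decomposition A l v \<longleftrightarrow>
     orthonormal_basis v \<and> (\<lambda>j. l j *\<^sub>R outer (v j) (v j)) sums A"

text \<open>
  Order of the eigenvalues of a possibly indefinite compact operator. A sequence that
  decreases and tends to \<open>0\<close> is non-negative, so with negative eigenvalues present the
  full list cannot decrease by value. Either the absolute values decrease, or the first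
  \<open>d\<close> entries are the \<open>d\<close> largest ones by value, in decreasing order, and the remaining
  ones are listed arbitrarily. Both agree with the usual order for non-negative operators.
\<close>

definition decreasing_eigenvalues :: "nat \<Rightarrow> (nat \<Rightarrow> real) \<Rightarrow> bool" where
  "decreasing_eigenvalues d l \<longleftrightarrow>
     decseq (\<lambda>j. \<bar>l j\<bar>) \<or> (\<forall>i<d. \<forall>j\<ge>i. l j \<le> l i)"


definition strictly_stationary ::
    "'a measure \<Rightarrow> (int \<Rightarrow> 'a \<Rightarrow> 'h::topological_space) \<Rightarrow> bool" where
  "strictly_stationary M \<epsilon> \<longleftrightarrow>
     (\<forall>i. \<epsilon> i \<in> borel_measurable M) \<and>
     (\<forall>J h. finite J \<longrightarrow>
        distr M (\<Pi>\<^sub>M i\<in>J. borel) (\<lambda>\<omega>. \<lambda>i\<in>J. \<epsilon> (i + h) \<omega>) =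
        distr M (\<Pi>\<^sub>M i\<in>J. borel) (\<lambda>\<omega>. \<lambda>i\<in>J. \<epsilon> i \<omega>))"

text \<open>The expectation of the random operator \<open>outer (\<epsilon> 0) (\<epsilon> h)\<close> is taken pointwise, because
  the space of bounded operators is not separable and hence no target of the library's
  Bochner integral.\<close>

definition autocov ::
    "'a measure \<Rightarrow> (int \<Rightarrow> 'a \<Rightarrow> 'h::{real_inner,banach,second_countable_topology}) \<Rightarrow>
     int \<Rightarrow> 'h \<Rightarrow>\<^sub>L 'h" where
  "autocov M \<epsilon> h = Blinfun (\<lambda>z. \<integral>\<omega>. blinfun_apply (outer (\<epsilon> 0 \<omega>) (\<epsilon> h \<omega>)) z \<partial>M)"

lemma autocov_apply:
  fixes \<epsilon> :: "int \<Rightarrow> 'a \<Rightarrow> 'h::{real_inner,banach,second_countable_topology}"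
  assumes meas: "\<And>i. \<epsilon> i \<in> borel_measurable M"
    and sq: "\<And>i. integrable M (\<lambda>\<omega>. (norm (\<epsilon> i \<omega>))\<^sup>2)"
  shows "blinfun_apply (autocov M \<epsilon> h) z = (\<integral>\<omega>. (\<epsilon> h \<omega> \<bullet> z) *\<^sub>R \<epsilon> 0 \<omega> \<partial>M)"
proof -
  let ?p = "\<lambda>\<omega>. norm (\<epsilon> h \<omega>) * norm (\<epsilon> 0 \<omega>)"
  have [measurable]: "\<epsilon> i \<in> borel_measurable M" for i by (rule meas)
  have p: "integrable M ?p"
  proof (rule Bochner_Integration.integrable_bound)
    show "integrable M (\<lambda>\<omega>. (norm (\<epsilon> h \<omega>))\<^sup>2 + (norm (\<epsilon> 0 \<omega>))\<^sup>2)"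
      using sq by (intro Bochner_Integration.integrable_add)
    have "x * y \<le> x\<^sup>2 + y\<^sup>2" if "0 \<le> x" "0 \<le> y" for x y :: real
    proof -
      have "2 * (x * y) \<le> x\<^sup>2 + y\<^sup>2"
        using sum_squares_bound[of x y] by simp
      moreover have "0 \<le> x * y" using that by simp
      ultimately show ?thesis by linarith
    qed
    then show "AE \<omega> in M. norm (?p \<omega>) \<le> norm ((norm (\<epsilon> h \<omega>))\<^sup>2 + (norm (\<epsilon> 0 \<omega>))\<^sup>2)"
      by (intro always_eventually allI) simp
  qed simp
  have bound: "norm ((\<epsilon> h \<omega> \<bullet> y) *\<^sub>R \<epsilon> 0 \<omega>) \<le> norm y * ?p \<omega>" for y \<omega>
  proof -
    have "\<bar>\<epsilon> h \<omega> \<bullet> y\<bar> * norm (\<epsilon> 0 \<omega>) \<le> (norm (\<epsilon> h \<omega>) * norm y) * norm (\<epsilon> 0 \<omega>)"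
      by (intro mult_right_mono Cauchy_Schwarz_ineq2) simp
    then show ?thesis by (simp add: ac_simps)
  qed
  have int: "integrable M (\<lambda>\<omega>. (\<epsilon> h \<omega> \<bullet> y) *\<^sub>R \<epsilon> 0 \<omega>)" for y
  proof (rule Bochner_Integration.integrable_bound)
    show "integrable M (\<lambda>\<omega>. norm y * ?p \<omega>)" using p by simp
    show "AE \<omega> in M. norm ((\<epsilon> h \<omega> \<bullet> y) *\<^sub>R \<epsilon> 0 \<omega>) \<le> norm (norm y * ?p \<omega>)"
      using bound by (intro always_eventually allI) (simp add: abs_mult)
  qed simp
  have "bounded_linear (\<lambda>y. \<integral>\<omega>. (\<epsilon> h \<omega> \<bullet> y) *\<^sub>R \<epsilon> 0 \<omega> \<partial>M)"
  proof (rule bounded_linear_intro)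
    fix y
    have "norm (\<integral>\<omega>. (\<epsilon> h \<omega> \<bullet> y) *\<^sub>R \<epsilon> 0 \<omega> \<partial>M) \<le> (\<integral>\<omega>. norm ((\<epsilon> h \<omega> \<bullet> y) *\<^sub>R \<epsilon> 0 \<omega>) \<partial>M)"
      by (rule integral_norm_bound)
    also have "\<dots> \<le> (\<integral>\<omega>. norm y * ?p \<omega> \<partial>M)"
      using p int bound by (intro integral_mono integrable_norm) simp_all
    finally show "norm (\<integral>\<omega>. (\<epsilon> h \<omega> \<bullet> y) *\<^sub>R \<epsilon> 0 \<omega> \<partial>M) \<le> norm y * (\<integral>\<omega>. ?p \<omega> \<partial>M)"
      by simp
  next
    fix x y
    show "(\<integral>\<omega>. (\<epsilon> h \<omega> \<bullet> (x + y)) *\<^sub>R \<epsilon> 0 \<omega> \<partial>M) =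
      (\<integral>\<omega>. (\<epsilon> h \<omega> \<bullet> x) *\<^sub>R \<epsilon> 0 \<omega> \<partial>M) + (\<integral>\<omega>. (\<epsilon> h \<omega> \<bullet> y) *\<^sub>R \<epsilon> 0 \<omega> \<partial>M)"
      using int by (simp add: inner_add_right scaleR_left_distrib Bochner_Integration.integral_add)
  next
    fix c y
    show "(\<integral>\<omega>. (\<epsilon> h \<omega> \<bullet> (c *\<^sub>R y)) *\<^sub>R \<epsilon> 0 \<omega> \<partial>M) = c *\<^sub>R (\<integral>\<omega>. (\<epsilon> h \<omega> \<bullet> y) *\<^sub>R \<epsilon> 0 \<omega> \<partial>M)"
      by (simp flip: integral_scaleR_right scaleR_scaleR)
  qed
  then show ?thesis
    by (simp add: autocov_def outer.rep_eq bounded_linear_Blinfun_apply)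
qed

definition long_run_cov ::
    "'a measure \<Rightarrow> (int \<Rightarrow> 'a \<Rightarrow> 'h::{real_inner,banach,second_countable_topology}) \<Rightarrow>
     'h \<Rightarrow>\<^sub>L 'h" where
  "long_run_cov M \<epsilon> = (\<Sum>\<^sub>\<infinity>h\<in>UNIV. autocov M \<epsilon> h)"

definition o_P_one :: "'a measure \<Rightarrow> (nat \<Rightarrow> 'a \<Rightarrow> real) \<Rightarrow> bool" where
  "o_P_one M X \<longleftrightarrow>
     (\<forall>\<delta>>0. (\<lambda>n. measure M {\<omega> \<in> space M. \<delta> < \<bar>X n \<omega>\<bar>}) \<longlonglongrightarrow> 0)"

definition O_P_one :: "'a measure \<Rightarrow> (nat \<Rightarrow> 'a \<Rightarrow> real) \<Rightarrow> bool" where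
  "O_P_one M X \<longleftrightarrow>
     (\<forall>\<delta>>0. \<exists>K. \<forall>\<^sub>F n in sequentially. measure M {\<omega> \<in> space M. K < \<bar>X n \<omega>\<bar>} < \<delta>)"

text \<open>Convergence in distribution of extended real valued random variables to a real valued one:
  \<open>weak_conv_m\<close> with the distribution function of \<open>X n\<close> restricted to finite arguments.\<close>

definition weak_conv_ereal ::
    "'a measure \<Rightarrow> (nat \<Rightarrow> 'a \<Rightarrow> ereal) \<Rightarrow> real measure \<Rightarrow> bool" where
  "weak_conv_ereal M X L \<longleftrightarrow>
     (\<forall>\<^sub>F n in sequentially. X n \<in> borel_measurable M) \<and>
     weak_conv (\<lambda>n x. measure M {\<omega> \<in> space M. X n \<omega> \<le> ereal x}) (cdf L)"

lemma weak_conv_ereal_iff_weak_conv_m: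
  assumes X: "\<And>n. X n \<in> borel_measurable M"
  shows "weak_conv_ereal M (\<lambda>n \<omega>. ereal (X n \<omega>)) L \<longleftrightarrow>
         weak_conv_m (\<lambda>n. distr M borel (X n)) L"
proof -
  have "measure M {\<omega> \<in> space M. X n \<omega> \<le> x} = cdf (distr M borel (X n)) x" for n x
    using X by (auto simp: cdf_def measure_distr intro!: arg_cong[where f="measure M"])
  then show ?thesis
    using X by (simp add: weak_conv_ereal_def weak_conv_m_def)
qed

definition gaussian_rv :: "'b measure \<Rightarrow> ('b \<Rightarrow> real) \<Rightarrow> bool" where
  "gaussian_rv N X \<longleftrightarrow> X \<in> borel_measurable N \<and>
     (\<exists>\<mu> \<sigma>. (\<sigma> = 0 \<and> (AE \<omega> in N. X \<omega> = \<mu>)) \<or>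
            (\<sigma> > 0 \<and> distributed N lborel X (normal_density \<mu> \<sigma>)))"

definition brownian_bridge :: "'b measure \<Rightarrow> (real \<Rightarrow> 'b \<Rightarrow> real) \<Rightarrow> bool" where
  "brownian_bridge N B \<longleftrightarrow>
     (\<forall>J a. finite J \<and> J \<subseteq> {0..1} \<longrightarrow> gaussian_rv N (\<lambda>\<omega>. \<Sum>x\<in>J. a x * B x \<omega>)) \<and>
     (\<forall>x\<in>{0..1}. (\<integral>\<omega>. B x \<omega> \<partial>N) = 0) \<and>
     (\<forall>x\<in>{0..1}. \<forall>y\<in>{0..1}. (\<integral>\<omega>. B x \<omega> * B y \<omega> \<partial>N) = min x y - x * y) \<and>
     (\<forall>\<omega>\<in>space N. continuous_on {0..1} (\<lambda>x. B x \<omega>))"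

definition independent_brownian_bridges ::
    "'b measure \<Rightarrow> nat \<Rightarrow> (nat \<Rightarrow> real \<Rightarrow> 'b \<Rightarrow> real) \<Rightarrow> bool" where
  "independent_brownian_bridges N d B \<longleftrightarrow>
     prob_space N \<and> (\<forall>r<d. brownian_bridge N (B r)) \<and>
     prob_space.indep_vars N (\<lambda>_. \<Pi>\<^sub>M x\<in>{0..1::real}. borel)
       (\<lambda>r \<omega>. \<lambda>x\<in>{0..1}. B r x \<omega>) {..<d}"

definition sup_bridges :: "nat \<Rightarrow> (nat \<Rightarrow> real \<Rightarrow> 'b \<Rightarrow> real) \<Rightarrow> 'b \<Rightarrow> real" where
  "sup_bridges d B \<omega> = (SUP x\<in>{0..1}. sqrt (\<Sum>r<d. (B r x \<omega>)\<^sup>2))"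


text \<open>Lipschitz on every open subinterval of the unit interval that avoids finitely many break
  points; nothing is required of the values at the break points.\<close>

definition piecewise_lipschitz :: "(real \<Rightarrow> real) \<Rightarrow> bool" where
  "piecewise_lipschitz g \<longleftrightarrow>
     (\<exists>P L. finite P \<and>
        (\<forall>a b. {a<..<b} \<subseteq> {0..1} \<and> {a<..<b} \<inter> P = {} \<longrightarrow> L-lipschitz_on {a<..<b} g))"

definition observation ::
    "(real \<Rightarrow> real) \<Rightarrow> 'h::real_vector \<Rightarrow> (int \<Rightarrow> 'a \<Rightarrow> 'h) \<Rightarrow> nat \<Rightarrow> 'a \<Rightarrow> nat \<Rightarrow> 'h" where
  "observation g \<Delta> \<epsilon> n \<omega> i = g (real i / real n) *\<^sub>R \<Delta> + \<epsilon> (int i) \<omega>"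

definition cusum :: "nat \<Rightarrow> nat \<Rightarrow> (nat \<Rightarrow> 'v::real_vector) \<Rightarrow> 'v" where
  "cusum n k x =
     (1 / sqrt (real n)) *\<^sub>R (\<Sum>i=1..k. x i - (1 / real n) *\<^sub>R (\<Sum>l=1..n. x l))"

text \<open>Maximum over \<open>k\<close> of the Euclidean norm of the \<open>k\<close>-th partial sum of the \<open>d\<close>-dimensional
  score series, each coordinate being scaled by the inverse square root of its eigenvalue.\<close>

definition max_statistic ::
    "nat \<Rightarrow> nat \<Rightarrow> (nat \<Rightarrow> real) \<Rightarrow> (nat \<Rightarrow> 'h) \<Rightarrow> (nat \<Rightarrow> 'h::real_inner) \<Rightarrow> real" where
  "max_statistic n d l v x =
     (MAX k\<in>{1..<n}. L2_set (\<lambda>r. cusum n k (\<lambda>i. x i \<bullet> v r) / sqrt (l r)) {..<d})"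

text \<open>\<open>aligned n \<gamma> k w x\<close> is the change-aligned version of the direction \<open>w\<close>, where \<open>k\<close> is
  the estimated change point of the series \<open>x\<close>.\<close>

definition aligned :: "nat \<Rightarrow> real \<Rightarrow> nat \<Rightarrow> 'h \<Rightarrow> (nat \<Rightarrow> 'h::real_inner) \<Rightarrow> 'h" where
  "aligned n \<gamma> k w x =
     (let u = (1 / sqrt (real n)) *\<^sub>R cusum n k x;
          s = (if w \<bullet> u \<ge> 0 then 1 else - 1);
          y = (1 / real n powr \<gamma>) *\<^sub>R w + s *\<^sub>R u
      in (1 / norm y) *\<^sub>R y)"

definition adjusted_statistic ::
    "nat \<Rightarrow> nat \<Rightarrow> real \<Rightarrow> nat \<Rightarrow> (nat \<Rightarrow> real) \<Rightarrow> (nat \<Rightarrow> 'h) \<Rightarrow> (nat \<Rightarrow> 'h::real_inner) \<Rightarrow> ereal"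
  where
  "adjusted_statistic n d \<gamma> k l v x =
     (if \<exists>j<d. l j = 0 then \<infinity>
      else ereal (max_statistic n d (\<lambda>j. \<bar>l j\<bar>) (v(0 := aligned n \<gamma> k (v 0) x)) x))"

end

theory Submission
  imports Defs
begin

text \<open>
  Without a change the signal cancels in the partial sums \<open>S k\<close>, so only the noise enters, and by
  assumption \<open>max k (norm (S k))\<close> is stochastically bounded. It therefore suffices to compare the
  adjusted statistic with the one built from the true eigenelements: the two differ by a quantity
  that tends to zero in probability, and Slutsky's lemma carries the limit over
  (\<open>weak_conv_ereal_slutsky\<close>). The comparison is deterministic, on the event that the maximum is
  at most \<open>K\<close> and the Hilbert-Schmidt distance of the two operators is at most \<open>\<eta>\<close>
  (\<open>adjusted_statistic_close\<close>). It has two parts.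

  The aligned direction is the normalization of \<open>w\<close> plus or minus \<open>n powr (\<gamma> - 1/2) S k\<close>, where \<open>w\<close>
  is the first estimated eigenvector; as \<open>\<gamma> < 1/2\<close>, it is asymptotically equal to \<open>w\<close>
  (\<open>aligned_close\<close>).

  Replacing the estimated eigenelements by the true ones is less direct, because eigenvalues may
  coincide and then single eigenvectors do not converge, not even up to sign. But the statistic
  depends on them only through the norm of \<open>f A x\<close>, where \<open>f\<close> is the inverse square root on the
  first \<open>d\<close> eigenvalues and zero on the rest. Let \<open>v i\<close>, \<open>l i\<close> and \<open>w j\<close>, \<open>m j\<close> be
  eigenvectors and eigenvalues of \<open>A\<close> and \<open>B\<close>. The entries of \<open>A - B\<close> between the two
  eigenbases are \<open>(l i - m j) (w j \<bullet> v i)\<close>, those of \<open>f A - f B\<close> are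
  \<open>(f (l i) - f (m j)) (w j \<bullet> v i)\<close>. If \<open>f\<close> is Lipschitz on the two spectra, then
  \<open>f A - f B\<close> is thus bounded, in Hilbert-Schmidt norm, by a multiple of \<open>A - B\<close>
  (\<open>weighted_score_norm_perturbation\<close>). The Lipschitz property holds because the \<open>d\<close> leading
  eigenvalues are separated from the others, for \<open>B\<close> as well as for \<open>A\<close>. This is deduced from the same
  entries: the squared mass \<open>(w j \<bullet> v i)\<^sup>2\<close> is concentrated where \<open>l i\<close> and \<open>m j\<close> are close,
  and counting it by rows and by columns shows that \<open>A\<close> and \<open>B\<close> have the same number of
  eigenvalues above the gap (\<open>card_le_of_spectral_gap\<close>, \<open>leading_eigenvalues_separated\<close>).
\<close>

section \<open>Orthonormal bases\<close>

lemma orthonormal_basis_inner: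
  "orthonormal_basis e \<Longrightarrow> e i \<bullet> e j = (if i = j then 1 else 0)"
  by (simp add: orthonormal_basis_def)

lemma orthonormal_basis_norm: "orthonormal_basis e \<Longrightarrow> norm (e i) = 1"
  by (simp add: norm_eq_sqrt_inner orthonormal_basis_inner)

lemma orthonormal_sum_inner:
  assumes "orthonormal_basis e" "finite F"
  shows "(\<Sum>j\<in>F. c j *\<^sub>R e j) \<bullet> e i = (if i \<in> F then c i else 0)"
proof -
  have "(\<Sum>j\<in>F. c j *\<^sub>R e j) \<bullet> e i = (\<Sum>j\<in>F. if j = i then c j else 0)"
    by (simp add: inner_sum_left orthonormal_basis_inner[OF assms(1)] if_distrib cong: if_cong)
  then show ?thesis
    using assms(2) by simp
qed

lemma orthonormal_sum_norm:
  assumes "orthonormal_basis e" "finite F"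
  shows "(norm (\<Sum>j\<in>F. c j *\<^sub>R e j))\<^sup>2 = (\<Sum>j\<in>F. (c j)\<^sup>2)"
  by (simp add: power2_norm_eq_inner inner_sum_right orthonormal_sum_inner[OF assms]
      cong: sum.cong) (simp add: power2_eq_square)

lemma bessel:
  assumes e: "orthonormal_basis e" and F: "finite F"
  shows "(\<Sum>j\<in>F. (x \<bullet> e j)\<^sup>2) \<le> (norm x)\<^sup>2"
proof -
  let ?p = "\<Sum>j\<in>F. (x \<bullet> e j) *\<^sub>R e j"
  have "(norm (x - ?p))\<^sup>2 = (norm x)\<^sup>2 - 2 * (x \<bullet> ?p) + (norm ?p)\<^sup>2"
    by (simp add: power2_norm_eq_inner inner_diff_left inner_diff_right inner_commute)
  moreover have "x \<bullet> ?p = (\<Sum>j\<in>F. (x \<bullet> e j)\<^sup>2)"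
    by (simp add: inner_sum_right power2_eq_square)
  ultimately show ?thesis
    using orthonormal_sum_norm[OF e F, of "\<lambda>j. x \<bullet> e j"] zero_le_power2[of "norm (x - ?p)"]
    by simp
qed

text \<open>
  The vectors that their Fourier series represents form a subspace containing the basis;
  since the partial sum operators are contractions, it is closed, hence everything.
\<close>

lemma fourier_series_sums:
  fixes x :: "'h::real_inner"
  assumes e: "orthonormal_basis e"
  shows "(\<lambda>j. (x \<bullet> e j) *\<^sub>R e j) sums x"
proof -
  define P where "P m y = (\<Sum>j<m. (y \<bullet> e j) *\<^sub>R e j)" for m and y :: 'h
  have P_add: "P m (y + z) = P m y + P m z" for m y z
    by (simp add: P_def inner_add_left scaleR_left_distrib sum.distrib)
  have P_scale: "P m (c *\<^sub>R y) = c *\<^sub>R P m y" for m c y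
    by (simp add: P_def scaleR_sum_right)
  have P_norm: "norm (P m y) \<le> norm y" for m y
    by (rule power2_le_imp_le[OF _ norm_ge_zero])
      (simp add: P_def orthonormal_sum_norm[OF e finite_lessThan] bessel[OF e finite_lessThan])
  have P_zero: "P m 0 = 0" for m
    by (simp add: P_def)
  have "(\<lambda>m. P m s) \<longlonglongrightarrow> s" if "s \<in> span (range e)" for s
  proof (rule span_induct[OF that])
    show "subspace {s. (\<lambda>m. P m s) \<longlonglongrightarrow> s}"
      by (auto simp: subspace_def P_zero P_add P_scale intro: tendsto_add tendsto_scaleR)
    fix y assume "y \<in> range e"
    then obtain k where k: "y = e k" by auto
    have "P m y = (\<Sum>j<m. if j = k then y else 0)" for m
      unfolding P_def k by (rule sum.cong) (auto simp: orthonormal_basis_inner[OF e])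
    then have "P m y = y" if "k < m" for m
      using that by simp
    then show "(\<lambda>m. P m y) \<longlonglongrightarrow> y"
      by (intro tendsto_eventually) (auto intro: eventually_mono[OF eventually_gt_at_top[of k]])
  qed
  moreover have "x \<in> closure (span (range e))"
    using e by (simp add: orthonormal_basis_def)
  ultimately have approx: "\<exists>s. norm (s - x) < r \<and> (\<lambda>m. P m s) \<longlonglongrightarrow> s" if "0 < r" for r
    using that unfolding closure_approachable by (metis dist_norm)
  have "(\<lambda>m. P m x) \<longlonglongrightarrow> x"
  proof (rule LIMSEQ_I)
    fix r :: real assume "0 < r"
    then obtain s where s: "norm (s - x) < r / 3" "(\<lambda>m. P m s) \<longlonglongrightarrow> s"
      using approx[of "r / 3"] by auto
    obtain m0 where m0: "\<And>m. m0 \<le> m \<Longrightarrow> norm (P m s - s) < r / 3"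
      using LIMSEQ_D[OF s(2), of "r / 3"] \<open>0 < r\<close> by auto
    have "norm (P m x - x) < r" if "m0 \<le> m" for m
    proof -
      have "P m s + P m (x - s) = P m x"
        by (simp flip: P_add)
      then have "P m x - x = P m (x - s) + (P m s - s) + (s - x)"
        by (simp add: algebra_simps)
      then have "norm (P m x - x) \<le> norm (P m (x - s)) + norm (P m s - s) + norm (s - x)"
        by (metis norm_triangle_mono norm_triangle_ineq order_refl)
      then show ?thesis
        using P_norm[of m "x - s"] m0[OF that] s(1) by (simp add: norm_minus_commute)
    qed
    then show "\<exists>m0. \<forall>m\<ge>m0. norm (P m x - x) < r" by blast
  qed
  then show ?thesis by (simp add: sums_def P_def)
qed

lemma parseval_sums:
  assumes e: "orthonormal_basis e"
  shows "(\<lambda>j. (x \<bullet> e j)\<^sup>2) sums (norm x)\<^sup>2"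
proof -
  have "(\<lambda>j. x \<bullet> ((x \<bullet> e j) *\<^sub>R e j)) sums (x \<bullet> x)"
    by (rule bounded_linear.sums[OF bounded_linear_inner_right fourier_series_sums[OF e]])
  then show ?thesis by (simp add: power2_norm_eq_inner) (simp add: power2_eq_square)
qed

text \<open>
  The sum on the left is the value of the functional at \<open>z = (\<Sum>i\<in>F. phi (f i) f i)\<close>; expanding
  \<open>z\<close> in the basis \<open>e\<close> and using Cauchy-Schwarz bounds it by
  \<open>norm z\<close> times the square root of the sum on the right, and \<open>(norm z)\<^sup>2\<close> is the left-hand sum again.
\<close>

lemma functional_square_sum_le:
  fixes \<phi> :: "'h::real_inner \<Rightarrow> real"
  assumes \<phi>: "bounded_linear \<phi>" and e: "orthonormal_basis e" and f: "orthonormal_basis f"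
    and F: "finite F" and sm: "summable (\<lambda>j. (\<phi> (e j))\<^sup>2)"
  shows "(\<Sum>i\<in>F. (\<phi> (f i))\<^sup>2) \<le> (\<Sum>j. (\<phi> (e j))\<^sup>2)"
proof -
  interpret bounded_linear \<phi> by (rule \<phi>)
  define z where "z = (\<Sum>i\<in>F. \<phi> (f i) *\<^sub>R f i)"
  define s where "s = (\<Sum>i\<in>F. (\<phi> (f i))\<^sup>2)"
  define q where "q = (\<Sum>j. (\<phi> (e j))\<^sup>2)"
  have s: "s = \<phi> z"
    by (simp add: s_def z_def sum scaleR power2_eq_square)
  have z: "(norm z)\<^sup>2 = s"
    unfolding z_def s_def by (rule orthonormal_sum_norm[OF f F])
  have "(\<lambda>j. (z \<bullet> e j) * \<phi> (e j)) sums \<phi> z"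
    using sums[OF fourier_series_sums[OF e, of z]] by (simp add: scaleR)
  then have "(\<lambda>m. \<Sum>j<m. (z \<bullet> e j) * \<phi> (e j)) \<longlonglongrightarrow> \<phi> z"
    by (simp add: sums_def)
  moreover have "(\<Sum>j<m. (z \<bullet> e j) * \<phi> (e j)) \<le> norm z * sqrt q" for m
  proof -
    have "(\<Sum>j<m. (z \<bullet> e j) * \<phi> (e j)) \<le> (\<Sum>j<m. \<bar>z \<bullet> e j\<bar> * \<bar>\<phi> (e j)\<bar>)"
      by (intro sum_mono) (metis abs_ge_self abs_mult)
    also have "\<dots> \<le> L2_set (\<lambda>j. z \<bullet> e j) {..<m} * L2_set (\<lambda>j. \<phi> (e j)) {..<m}"
      by (rule L2_set_mult_ineq)
    also have "\<dots> \<le> norm z * sqrt q"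
    proof (rule mult_mono)
      show "L2_set (\<lambda>j. z \<bullet> e j) {..<m} \<le> norm z"
        unfolding L2_set_def using bessel[OF e, of "{..<m}" z] by (simp add: real_le_lsqrt)
      show "L2_set (\<lambda>j. \<phi> (e j)) {..<m} \<le> sqrt q"
        unfolding L2_set_def q_def by (intro real_sqrt_le_mono sum_le_suminf sm) auto
    qed auto
    finally show ?thesis .
  qed
  ultimately have "\<phi> z \<le> norm z * sqrt q"
    by (intro LIMSEQ_le_const2) auto
  then have le: "s \<le> sqrt s * sqrt q"
    using z s by (metis norm_ge_zero real_sqrt_unique)
  have "0 \<le> s" by (simp add: s_def sum_nonneg)
  have "s \<le> q"
  proof (cases "s = 0")
    case True
    then show ?thesis by (simp add: q_def suminf_nonneg sm)
  next
    case False
    then have "sqrt s * sqrt s \<le> sqrt s * sqrt q" "0 < sqrt s"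
      using le \<open>0 \<le> s\<close> by auto
    then show ?thesis by (metis mult_le_cancel_left_pos real_sqrt_le_iff)
  qed
  then show ?thesis by (simp add: s_def q_def)
qed

section \<open>Hilbert-Schmidt operators\<close>

text \<open>
  Each coordinate \<open>x \<mapsto> A x \<bullet> e k\<close> is a functional to which the preceding bound applies. Only
  finitely many \<open>k\<close> are summed at a time, so that no two infinite sums have to be interchanged;
  Parseval's identity recovers \<open>norm (A (f i))\<close> in the limit.
\<close>

lemma hilbert_schmidt_sum_le:
  fixes A :: "'h::real_inner \<Rightarrow>\<^sub>L 'h"
  assumes e: "orthonormal_basis e" and f: "orthonormal_basis f"
    and sm: "summable (\<lambda>j. (norm (A (e j)))\<^sup>2)"
  shows "(\<Sum>i<m. (norm (A (f i)))\<^sup>2) \<le> (\<Sum>j. (norm (A (e j)))\<^sup>2)"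
proof -
  have "(\<lambda>K. \<Sum>i<m. \<Sum>k<K. (A (f i) \<bullet> e k)\<^sup>2) \<longlonglongrightarrow> (\<Sum>i<m. (norm (A (f i)))\<^sup>2)"
    using parseval_sums[OF e] by (intro tendsto_sum) (simp add: sums_def)
  moreover have "(\<Sum>i<m. \<Sum>k<K. (A (f i) \<bullet> e k)\<^sup>2) \<le> (\<Sum>j. (norm (A (e j)))\<^sup>2)" for K
  proof -
    have bl: "bounded_linear (\<lambda>y. A y \<bullet> e k)" for k
      by (intro bounded_linear_compose[OF bounded_linear_inner_left] blinfun.bounded_linear_right)
    have smk: "summable (\<lambda>j. (A (e j) \<bullet> e k)\<^sup>2)" for k
      using bessel[OF e, of "{k}"] by (intro summable_comparison_test[OF _ sm]) auto
    have "(\<Sum>i<m. \<Sum>k<K. (A (f i) \<bullet> e k)\<^sup>2) = (\<Sum>k<K. \<Sum>i<m. (A (f i) \<bullet> e k)\<^sup>2)"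
      by (rule sum.swap)
    also have "\<dots> \<le> (\<Sum>k<K. \<Sum>j. (A (e j) \<bullet> e k)\<^sup>2)"
      by (intro sum_mono functional_square_sum_le[OF bl e f _ smk]) auto
    also have "\<dots> = (\<Sum>j. \<Sum>k<K. (A (e j) \<bullet> e k)\<^sup>2)"
      by (rule suminf_sum[symmetric]) (rule smk)
    also have "\<dots> \<le> (\<Sum>j. (norm (A (e j)))\<^sup>2)"
      by (intro suminf_le bessel[OF e] summable_sum smk sm) auto
    finally show ?thesis .
  qed
  ultimately show ?thesis
    by (intro LIMSEQ_le_const2) auto
qed

text \<open>
  The bound of the partial sums is symmetric in the two bases, so the Hilbert-Schmidt norm may be
  evaluated in any basis.
\<close>

lemma hilbert_schmidt_sums:
  fixes A :: "'h::real_inner \<Rightarrow>\<^sub>L 'h"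
  assumes A: "hilbert_schmidt A" and f: "orthonormal_basis f"
  shows "(\<lambda>j. (norm (A (f j)))\<^sup>2) sums (hs_norm A)\<^sup>2"
proof -
  obtain e where e: "orthonormal_basis e" "summable (\<lambda>j. (norm (A (e j)))\<^sup>2)"
    using A unfolding hilbert_schmidt_def by blast
  have sm: "summable (\<lambda>j. (norm (A (h j)))\<^sup>2)" if "orthonormal_basis h" for h
    using hilbert_schmidt_sum_le[OF e(1) that e(2)] by (intro summableI_nonneg_bounded) auto
  have le: "(\<Sum>j. (norm (A (h j)))\<^sup>2) \<le> (\<Sum>j. (norm (A (h' j)))\<^sup>2)"
    if "orthonormal_basis h" "orthonormal_basis h'" for h h'
    using hilbert_schmidt_sum_le[OF that(2,1) sm[OF that(2)]] by (intro suminf_le_const sm that) auto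
  have some: "orthonormal_basis (SOME e::nat \<Rightarrow> 'h. orthonormal_basis e)"
    using f by (rule someI[of orthonormal_basis])
  have "(hs_norm A)\<^sup>2 = (\<Sum>j. (norm (A ((SOME e. orthonormal_basis e) j)))\<^sup>2)"
    unfolding hs_norm_def Let_def by (simp add: suminf_nonneg sm[OF some])
  also have "\<dots> = (\<Sum>j. (norm (A (f j)))\<^sup>2)"
    by (intro antisym le some f)
  finally show ?thesis
    using sm[OF f] by (simp add: summable_sums)
qed

lemma hs_norm_nonneg:
  fixes A :: "'h::real_inner \<Rightarrow>\<^sub>L 'h"
  assumes "hilbert_schmidt A"
  shows "0 \<le> hs_norm A"
proof -
  obtain f :: "nat \<Rightarrow> 'h" where f: "orthonormal_basis f"
    using assms unfolding hilbert_schmidt_def by blast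
  have "orthonormal_basis (SOME e::nat \<Rightarrow> 'h. orthonormal_basis e)"
    using f by (rule someI[of orthonormal_basis])
  then show ?thesis
    unfolding hs_norm_def Let_def
    by (intro real_sqrt_ge_zero suminf_nonneg sums_summable[OF hilbert_schmidt_sums[OF assms]]) auto
qed

lemma hilbert_schmidt_finite_sum_le:
  fixes A :: "'h::real_inner \<Rightarrow>\<^sub>L 'h"
  assumes A: "hilbert_schmidt A" and f: "orthonormal_basis f" and F: "finite F"
  shows "(\<Sum>j\<in>F. (norm (A (f j)))\<^sup>2) \<le> (hs_norm A)\<^sup>2"
  unfolding sums_unique[OF hilbert_schmidt_sums[OF A f]]
  by (rule sum_le_suminf[OF sums_summable[OF hilbert_schmidt_sums[OF A f]] F]) simp

text \<open>Cauchy-Schwarz for the Fourier series of \<open>x\<close>, mapped termwise by \<open>T\<close>.\<close>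

lemma norm_le_of_basis_square_sum:
  fixes T :: "'h::real_inner \<Rightarrow> 'k::real_normed_vector"
  assumes T: "bounded_linear T" and e: "orthonormal_basis e" and c: "0 \<le> c"
    and bound: "\<And>m. (\<Sum>j<m. (norm (T (e j)))\<^sup>2) \<le> c\<^sup>2"
  shows "norm (T x) \<le> c * norm x"
proof -
  interpret bounded_linear T by (rule T)
  have "(\<lambda>m. \<Sum>j<m. (x \<bullet> e j) *\<^sub>R T (e j)) \<longlonglongrightarrow> T x"
    using sums[OF fourier_series_sums[OF e, of x]] by (simp add: scaleR sums_def)
  moreover have "norm (\<Sum>j<m. (x \<bullet> e j) *\<^sub>R T (e j)) \<le> c * norm x" for m
  proof -
    have "norm (\<Sum>j<m. (x \<bullet> e j) *\<^sub>R T (e j)) \<le> (\<Sum>j<m. \<bar>norm (T (e j))\<bar> * \<bar>x \<bullet> e j\<bar>)"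
      by (rule sum_norm_le) (simp add: mult.commute)
    also have "\<dots> \<le> L2_set (\<lambda>j. norm (T (e j))) {..<m} * L2_set (\<lambda>j. x \<bullet> e j) {..<m}"
      by (rule L2_set_mult_ineq)
    also have "\<dots> \<le> c * norm x"
      unfolding L2_set_def using bessel[OF e, of "{..<m}" x] bound[of m] c
      by (intro mult_mono real_sqrt_ge_zero sum_nonneg) (auto simp: real_le_lsqrt)
    finally show ?thesis .
  qed
  ultimately show ?thesis
    by (intro LIMSEQ_le_const2[OF tendsto_norm]) auto
qed

lemma norm_le_hs_norm:
  fixes A :: "'h::real_inner \<Rightarrow>\<^sub>L 'h"
  assumes A: "hilbert_schmidt A"
  shows "norm A \<le> hs_norm A"
proof -
  obtain e :: "nat \<Rightarrow> 'h" where e: "orthonormal_basis e"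
    using A unfolding hilbert_schmidt_def by blast
  have "norm (A x) \<le> hs_norm A * norm x" for x
    by (rule norm_le_of_basis_square_sum[OF blinfun.bounded_linear_right e hs_norm_nonneg[OF A]])
      (rule hilbert_schmidt_finite_sum_le[OF A e finite_lessThan])
  then show ?thesis
    by (rule norm_blinfun_bound[OF hs_norm_nonneg[OF A]])
qed

lemma hilbert_schmidt_diff:
  fixes A B :: "'h::real_inner \<Rightarrow>\<^sub>L 'h"
  assumes A: "hilbert_schmidt A" and B: "hilbert_schmidt B"
  shows "hilbert_schmidt (A - B)"
proof -
  obtain e :: "nat \<Rightarrow> 'h" where e: "orthonormal_basis e"
    using A unfolding hilbert_schmidt_def by blast
  have "(norm (x - y))\<^sup>2 \<le> 2 * (norm x)\<^sup>2 + 2 * (norm y)\<^sup>2" for x y :: 'h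
    using zero_le_power2[of "norm (x + y)"]
    by (simp add: power2_norm_eq_inner algebra_simps inner_commute)
  moreover have "summable (\<lambda>j. 2 * (norm (A (e j)))\<^sup>2 + 2 * (norm (B (e j)))\<^sup>2)"
    by (intro summable_add summable_mult sums_summable[OF hilbert_schmidt_sums[OF _ e]] A B)
  ultimately have "summable (\<lambda>j. (norm ((A - B) (e j)))\<^sup>2)"
    by (elim summable_comparison_test[rotated]) (simp add: blinfun.diff_left)
  then show ?thesis
    using e by (auto simp: hilbert_schmidt_def)
qed

text \<open>
  The partial sums converge in operator norm, which the Hilbert-Schmidt norm dominates; and by the
  triangle inequality in \<open>\<ell>\<^sup>2\<close> every finite section of the Hilbert-Schmidt sum of a partial sum
  is bounded by the total of the Hilbert-Schmidt norms, a bound that passes to the limit.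
\<close>

lemma hilbert_schmidt_infsum:
  fixes A :: "'i \<Rightarrow> 'h::{real_inner,banach} \<Rightarrow>\<^sub>L 'h"
  assumes hs: "\<And>i. i \<in> I \<Longrightarrow> hilbert_schmidt (A i)"
    and sm: "(\<lambda>i. hs_norm (A i)) summable_on I"
    and ex: "orthonormal_basis (e :: nat \<Rightarrow> 'h)"
  shows "hilbert_schmidt (\<Sum>\<^sub>\<infinity>i\<in>I. A i)"
proof -
  let ?S = "\<Sum>\<^sub>\<infinity>i\<in>I. A i" and ?K = "\<Sum>\<^sub>\<infinity>i\<in>I. hs_norm (A i)"
  have "(\<lambda>i. norm (A i)) summable_on I"
    by (rule summable_on_comparison_test[OF sm norm_le_hs_norm[OF hs]]) auto
  then have "(A has_sum ?S) I"
    by (rule has_sum_infsum[OF abs_summable_summable])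
  then have lim: "((\<lambda>F. \<Sum>i\<in>F. A i) \<longlongrightarrow> ?S) (finite_subsets_at_top I)"
    by (simp add: has_sum_def)
  have K0: "0 \<le> ?K"
    by (rule infsum_nonneg) (rule hs_norm_nonneg[OF hs])
  have "L2_set (\<lambda>j. norm (?S (e j))) {..<m} \<le> ?K" for m
  proof (rule tendsto_upperbound)
    show "((\<lambda>F. L2_set (\<lambda>j. norm ((\<Sum>i\<in>F. A i) (e j))) {..<m}) \<longlongrightarrow>
        L2_set (\<lambda>j. norm (?S (e j))) {..<m}) (finite_subsets_at_top I)"
      unfolding L2_set_def by (intro tendsto_intros lim)
    have "L2_set (\<lambda>j. norm ((\<Sum>i\<in>F. A i) (e j))) {..<m} \<le> (\<Sum>i\<in>F. hs_norm (A i))"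
      if "finite F" "F \<subseteq> I" for F
      using that
    proof (induction F rule: finite_induct)
      case empty
      then show ?case by (simp add: L2_set_def)
    next
      case (insert i F)
      have "L2_set (\<lambda>j. norm ((\<Sum>i\<in>insert i F. A i) (e j))) {..<m} \<le>
          L2_set (\<lambda>j. norm (A i (e j)) + norm ((\<Sum>i\<in>F. A i) (e j))) {..<m}"
        using insert by (intro L2_set_mono) (auto simp: blinfun.add_left intro: norm_triangle_ineq)
      also have "\<dots> \<le> L2_set (\<lambda>j. norm (A i (e j))) {..<m} +
          L2_set (\<lambda>j. norm ((\<Sum>i\<in>F. A i) (e j))) {..<m}"
        by (rule L2_set_triangle_ineq)
      also have "L2_set (\<lambda>j. norm (A i (e j))) {..<m} \<le> hs_norm (A i)"
        using hilbert_schmidt_finite_sum_le[OF hs ex, of i "{..<m}"] hs_norm_nonneg[OF hs, of i]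
          insert.prems
        unfolding L2_set_def by (intro real_le_lsqrt) auto
      finally show ?case
        using insert by auto
    qed
    moreover have "(\<Sum>i\<in>F. hs_norm (A i)) \<le> ?K" if "finite F" "F \<subseteq> I" for F
      using that by (intro finite_sum_le_infsum sm hs_norm_nonneg hs) auto
    ultimately show "\<forall>\<^sub>F F in finite_subsets_at_top I.
        L2_set (\<lambda>j. norm ((\<Sum>i\<in>F. A i) (e j))) {..<m} \<le> ?K"
      by (intro eventually_finite_subsets_at_top_weakI) (meson order_trans)
  qed simp
  then have "(\<Sum>j<m. (norm (?S (e j)))\<^sup>2) \<le> ?K\<^sup>2" for m
    unfolding L2_set_def by (metis sqrt_le_D)
  then have "summable (\<lambda>j. (norm (?S (e j)))\<^sup>2)"
    by (intro summableI_nonneg_bounded) auto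
  then show ?thesis
    using ex by (auto simp: hilbert_schmidt_def)
qed

section \<open>Perturbation of the leading spectral components\<close>

lemma spectral_decomposition_eigenvector:
  assumes "spectral_decomposition A l v"
  shows "blinfun_apply A (v i) = l i *\<^sub>R v i"
proof -
  have v: "orthonormal_basis v" and A: "(\<lambda>j. l j *\<^sub>R outer (v j) (v j)) sums A"
    using assms by (auto simp: spectral_decomposition_def)
  have "(\<lambda>j. blinfun_apply (l j *\<^sub>R outer (v j) (v j)) (v i)) sums blinfun_apply A (v i)"
    by (rule bounded_linear.sums[OF blinfun.bounded_linear_left A])
  also have "(\<lambda>j. blinfun_apply (l j *\<^sub>R outer (v j) (v j)) (v i)) =
      (\<lambda>j. if j = i then l j *\<^sub>R v j else 0)"
    by (auto simp: fun_eq_iff blinfun.scaleR_left outer.rep_eq orthonormal_basis_inner[OF v])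
  finally show ?thesis
    using sums_unique2 sums_single[of i "\<lambda>j. l j *\<^sub>R v j"] by blast
qed

lemma spectral_decomposition_inner:
  assumes "spectral_decomposition A l v"
  shows "blinfun_apply A x \<bullet> v i = l i * (x \<bullet> v i)"
proof -
  have v: "orthonormal_basis v" and A: "(\<lambda>j. l j *\<^sub>R outer (v j) (v j)) sums A"
    using assms by (auto simp: spectral_decomposition_def)
  have "bounded_linear (\<lambda>T. blinfun_apply T x \<bullet> v i)"
    by (rule bounded_linear_compose[OF bounded_linear_inner_left blinfun.bounded_linear_left])
  then have "(\<lambda>j. blinfun_apply (l j *\<^sub>R outer (v j) (v j)) x \<bullet> v i) sums (blinfun_apply A x \<bullet> v i)"
    by (rule bounded_linear.sums[OF _ A])
  also have "(\<lambda>j. blinfun_apply (l j *\<^sub>R outer (v j) (v j)) x \<bullet> v i) =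
      (\<lambda>j. if j = i then l j * (x \<bullet> v j) else 0)"
    by (auto simp: fun_eq_iff blinfun.scaleR_left outer.rep_eq orthonormal_basis_inner[OF v]
        inner_commute)
  finally show ?thesis
    using sums_unique2 sums_single[of i "\<lambda>j. l j * (x \<bullet> v j)"] by blast
qed

lemma spectral_decomposition_diff_inner:
  assumes "spectral_decomposition A l v" "spectral_decomposition B m w"
  shows "(A - B) (w j) \<bullet> v i = (l i - m j) * (w j \<bullet> v i)"
  using assms
  by (simp add: blinfun.diff_left inner_diff_left spectral_decomposition_inner
      spectral_decomposition_eigenvector algebra_simps)

text \<open>
  By Parseval's identity in the basis \<open>v\<close>: outside \<open>I\<close> every coefficient of \<open>(A - B) (w j)\<close>
  exceeds that of \<open>w j\<close> by a factor of at least \<open>c\<close>.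
\<close>

lemma spectral_gap_leakage:
  assumes A: "spectral_decomposition A l v" and B: "spectral_decomposition B m w"
    and I: "finite I" and c: "0 \<le> c" and gap: "\<And>i. i \<notin> I \<Longrightarrow> c \<le> \<bar>l i - m j\<bar>"
  shows "c\<^sup>2 * (1 - (\<Sum>i\<in>I. (w j \<bullet> v i)\<^sup>2)) \<le> (norm ((A - B) (w j)))\<^sup>2"
proof -
  have v: "orthonormal_basis v" and w: "orthonormal_basis w"
    using A B by (auto simp: spectral_decomposition_def)
  let ?a = "\<lambda>i. (w j \<bullet> v i)\<^sup>2"
  have "?a sums 1"
    using parseval_sums[OF v, of "w j"] by (simp add: orthonormal_basis_norm[OF w])
  then have mass: "(\<lambda>i. c\<^sup>2 * (?a i - (if i \<in> I then ?a i else 0))) sums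
      (c\<^sup>2 * (1 - (\<Sum>i\<in>I. ?a i)))"
    by (intro sums_mult sums_diff sums_If_finite_set I)
  have "c\<^sup>2 * (?a i - (if i \<in> I then ?a i else 0)) \<le> ((A - B) (w j) \<bullet> v i)\<^sup>2" for i
  proof (cases "i \<in> I")
    case False
    then have "c\<^sup>2 \<le> (l i - m j)\<^sup>2"
      using power_mono[OF gap c, of i 2] by simp
    with False show ?thesis
      by (simp add: spectral_decomposition_diff_inner[OF A B] power_mult_distrib mult_right_mono)
  qed simp
  then show ?thesis
    by (rule sums_le[OF _ mass parseval_sums[OF v]])
qed

text \<open>
  A unit vector \<open>w j\<close> has squared mass one, of which only a small part lies outside the span of
  \<open>v i\<close>, \<open>i \<in> I\<close>, if its eigenvalue is far from the others. The mass that all the \<open>w j\<close>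
  together put on a fixed \<open>v i\<close> is at most one, so there cannot be more of them than elements of
  \<open>I\<close>. This replaces the min-max principle.
\<close>

lemma card_le_of_spectral_gap:
  assumes A: "spectral_decomposition A l v" and B: "spectral_decomposition B m w"
    and hs: "hilbert_schmidt (A - B)" and small: "hs_norm (A - B) < c"
    and I: "finite I" and J: "finite J"
    and gap: "\<And>i j. i \<notin> I \<Longrightarrow> j \<in> J \<Longrightarrow> c \<le> \<bar>l i - m j\<bar>"
  shows "card J \<le> card I"
proof -
  have v: "orthonormal_basis v" and w: "orthonormal_basis w"
    using A B by (auto simp: spectral_decomposition_def)
  have c: "0 < c"
    using small hs_norm_nonneg[OF hs] by linarith
  let ?s = "\<Sum>j\<in>J. \<Sum>i\<in>I. (w j \<bullet> v i)\<^sup>2"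
  have "c\<^sup>2 * (\<Sum>j\<in>J. 1 - (\<Sum>i\<in>I. (w j \<bullet> v i)\<^sup>2)) \<le> (\<Sum>j\<in>J. (norm ((A - B) (w j)))\<^sup>2)"
    unfolding sum_distrib_left using c gap
    by (intro sum_mono spectral_gap_leakage[OF A B I]) auto
  also have "\<dots> \<le> (hs_norm (A - B))\<^sup>2"
    by (rule hilbert_schmidt_finite_sum_le[OF hs w J])
  also have "\<dots> < c\<^sup>2 * 1"
    using small hs_norm_nonneg[OF hs] by (simp add: power_strict_mono)
  finally have "real (card J) - ?s < 1"
    using c by (simp add: sum_subtractf)
  moreover have "?s \<le> real (card I)"
  proof -
    have "?s = (\<Sum>i\<in>I. \<Sum>j\<in>J. (v i \<bullet> w j)\<^sup>2)"
      by (subst sum.swap) (simp add: inner_commute)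
    also have "\<dots> \<le> (\<Sum>i\<in>I. 1)"
      using bessel[OF w J] by (intro sum_mono) (metis orthonormal_basis_norm[OF v] power_one)
    finally show ?thesis by simp
  qed
  ultimately show ?thesis by linarith
qed

lemma hs_norm_minus_commute:
  fixes A B :: "'h::real_inner \<Rightarrow>\<^sub>L 'h"
  shows "hs_norm (A - B) = hs_norm (B - A)"
  by (simp add: hs_norm_def blinfun.diff_left norm_minus_commute)

text \<open>
  Counting in both directions shows that exactly \<open>d\<close> eigenvalues of \<open>B\<close> exceed the midpoint of
  the gap, and none is below its negative because \<open>A\<close> is non-negative. So each of the admissible
  orders lists these \<open>d\<close> eigenvalues first.
\<close>

lemma leading_eigenvalues_separated:
  fixes A B :: "'h::real_inner \<Rightarrow>\<^sub>L 'h"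
  assumes A: "spectral_decomposition A l v" and B: "spectral_decomposition B m w"
    and hsA: "hilbert_schmidt A" and hsB: "hilbert_schmidt B"
    and l: "decseq l" "\<And>j. 0 \<le> l j" and d: "1 \<le> d" and gap: "l d < l (d - 1)"
    and m: "decreasing_eigenvalues d m"
    and small: "hs_norm (A - B) < (l (d - 1) - l d) / 2"
  shows "(l (d - 1) + l d) / 2 < m j \<longleftrightarrow> j < d"
proof -
  define \<mu> where "\<mu> = (l (d - 1) + l d) / 2"
  define c where "c = (l (d - 1) - l d) / 2"
  define J where "J = {j. \<mu> < m j}"
  have hs: "hilbert_schmidt (A - B)" "hilbert_schmidt (B - A)"
    by (intro hilbert_schmidt_diff hsA hsB)+
  have c: "0 < c" "l d + c = \<mu>" "\<mu> + c = l (d - 1)" "c \<le> \<mu>"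
    using gap l(2)[of d] by (auto simp: \<mu>_def c_def field_simps)
  have top: "l (d - 1) \<le> l i" if "i < d" for i
    using that l(1) by (auto simp: decseq_def)
  have rest: "l i \<le> l d" if "\<not> i < d" for i
    using that l(1) by (auto simp: decseq_def)
  have small': "hs_norm (A - B) < c" "hs_norm (B - A) < c"
    using small by (auto simp: c_def hs_norm_minus_commute[of B A])
  have bound: "card F \<le> d" if "finite F" "F \<subseteq> J" for F
  proof -
    have "card F \<le> card {..<d}"
    proof (rule card_le_of_spectral_gap[OF A B hs(1) small'(1)])
      fix i j assume "i \<notin> {..<d}" "j \<in> F"
      then have "\<mu> < m j" "l i \<le> l d"
        using that rest by (auto simp: J_def)
      then show "c \<le> \<bar>l i - m j\<bar>" using c by linarith
    qed (use that in auto)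
    then show ?thesis by simp
  qed
  then have J: "finite J" "card J \<le> d"
    using finite_if_finite_subsets_card_bdd[of J d] by auto
  have "card {..<d} \<le> card J"
  proof (rule card_le_of_spectral_gap[OF B A hs(2) small'(2) J(1)])
    fix j i assume "j \<notin> J" "i \<in> {..<d}"
    then have "m j \<le> \<mu>" "l (d - 1) \<le> l i"
      using top by (auto simp: J_def)
    then show "c \<le> \<bar>m j - l i\<bar>" using c by linarith
  qed auto
  then have card_J: "card J = d"
    using J(2) by simp
  have above: "- \<mu> < m j" for j
  proof (rule ccontr)
    assume "\<not> - \<mu> < m j"
    then have "c \<le> \<bar>l i - m j\<bar>" for i
      using c l(2)[of i] by linarith
    then have "card {j} \<le> card ({} :: nat set)"
      by (intro card_le_of_spectral_gap[OF A B hs(1) small'(1)]) auto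
    then show False by simp
  qed
  have "J \<subseteq> {..<d}"
  proof
    fix j assume j: "j \<in> J"
    show "j \<in> {..<d}"
    proof (rule ccontr)
      assume "j \<notin> {..<d}"
      have "i \<in> J" if "i < d" for i
      proof -
        have "m j \<le> m i \<or> \<bar>m j\<bar> \<le> \<bar>m i\<bar>"
          using m that \<open>j \<notin> {..<d}\<close> by (auto simp: decreasing_eigenvalues_def decseq_def)
        then show ?thesis
          using j above[of i] c by (auto simp: J_def)
      qed
      then have "insert j {..<d} \<subseteq> J"
        using j by auto
      from card_mono[OF J(1) this] show False
        using \<open>j \<notin> {..<d}\<close> card_J by simp
    qed
  qed
  then have "J = {..<d}"
    using card_J by (intro card_subset_eq) auto
  then show ?thesis
    by (auto simp: J_def \<mu>_def)
qed

text \<open>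
  For a function of an operator the entries between the two eigenbases are those of the
  difference \<open>A - B\<close>, multiplied by a divided difference. A Lipschitz bound of the weights
  therefore transfers the Hilbert-Schmidt distance entry by entry, so that multiple eigenvalues,
  for which single eigenvectors need not converge, require no separate treatment.
\<close>

lemma weighted_score_norm_perturbation:
  fixes A B :: "'h::real_inner \<Rightarrow>\<^sub>L 'h"
  assumes A: "spectral_decomposition A l v" and B: "spectral_decomposition B m w"
    and hs: "hilbert_schmidt (A - B)" and L: "0 \<le> L"
    and lip: "\<And>i j. \<bar>f i - g j\<bar> \<le> L * \<bar>l i - m j\<bar>"
    and f: "\<And>i. d \<le> i \<Longrightarrow> f i = 0" and g: "\<And>j. d \<le> j \<Longrightarrow> g j = 0"
  shows "\<bar>L2_set (\<lambda>r. f r * (x \<bullet> v r)) {..<d} - L2_set (\<lambda>r. g r * (x \<bullet> w r)) {..<d}\<bar>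
    \<le> L * hs_norm (A - B) * norm x"
proof -
  have v: "orthonormal_basis v" and w: "orthonormal_basis w"
    using A B by (auto simp: spectral_decomposition_def)
  define P where "P x = (\<Sum>r<d. (f r * (x \<bullet> v r)) *\<^sub>R v r)" for x
  define Q where "Q x = (\<Sum>r<d. (g r * (x \<bullet> w r)) *\<^sub>R w r)" for x
  have lin: "bounded_linear (\<lambda>x. P x - Q x)"
    unfolding P_def Q_def
    by (intro bounded_linear_sub bounded_linear_sum bounded_linear_scaleR_const
        bounded_linear_const_mult bounded_linear_inner_left)
  have Pv: "P x \<bullet> v i = f i * (x \<bullet> v i)" for x i
    unfolding P_def using f[of i] by (simp add: orthonormal_sum_inner[OF v])
  have Qw: "Q (w j) = g j *\<^sub>R w j" for j
  proof -
    have "Q (w j) = (\<Sum>r<d. if r = j then g j *\<^sub>R w j else 0)"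
      unfolding Q_def by (rule sum.cong) (auto simp: orthonormal_basis_inner[OF w])
    then show ?thesis using g[of j] by simp
  qed
  have entry: "(norm (P (w j) - Q (w j)))\<^sup>2 \<le> L\<^sup>2 * (norm ((A - B) (w j)))\<^sup>2" for j
  proof (rule sums_le)
    show "(\<lambda>i. ((P (w j) - Q (w j)) \<bullet> v i)\<^sup>2) sums (norm (P (w j) - Q (w j)))\<^sup>2"
      by (rule parseval_sums[OF v])
    show "(\<lambda>i. L\<^sup>2 * ((A - B) (w j) \<bullet> v i)\<^sup>2) sums (L\<^sup>2 * (norm ((A - B) (w j)))\<^sup>2)"
      by (intro sums_mult parseval_sums[OF v])
    show "((P (w j) - Q (w j)) \<bullet> v i)\<^sup>2 \<le> L\<^sup>2 * ((A - B) (w j) \<bullet> v i)\<^sup>2" for i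
    proof -
      have "(P (w j) - Q (w j)) \<bullet> v i = (f i - g j) * (w j \<bullet> v i)"
        by (simp add: inner_diff_left Pv Qw left_diff_distrib)
      moreover have "(f i - g j)\<^sup>2 \<le> (L * (l i - m j))\<^sup>2"
        using lip[of i j] L by (simp add: abs_mult flip: abs_le_square_iff)
      ultimately show ?thesis
        by (simp add: spectral_decomposition_diff_inner[OF A B] power_mult_distrib
            mult_right_mono flip: mult.assoc)
    qed
  qed
  have "norm (P x - Q x) \<le> (L * hs_norm (A - B)) * norm x"
  proof (rule norm_le_of_basis_square_sum[OF lin w])
    show "(\<Sum>j<k. (norm (P (w j) - Q (w j)))\<^sup>2) \<le> (L * hs_norm (A - B))\<^sup>2" for k
    proof -
      have "(\<Sum>j<k. (norm (P (w j) - Q (w j)))\<^sup>2) \<le> L\<^sup>2 * (\<Sum>j<k. (norm ((A - B) (w j)))\<^sup>2)"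
        unfolding sum_distrib_left by (intro sum_mono entry)
      also have "\<dots> \<le> L\<^sup>2 * (hs_norm (A - B))\<^sup>2"
        by (intro mult_left_mono hilbert_schmidt_finite_sum_le[OF hs w]) auto
      finally show ?thesis by (simp add: power_mult_distrib)
    qed
  qed (simp add: L hs_norm_nonneg[OF hs])
  moreover have "norm (P x) = L2_set (\<lambda>r. f r * (x \<bullet> v r)) {..<d}"
    unfolding L2_set_def P_def
    by (simp flip: orthonormal_sum_norm[OF v finite_lessThan])
  moreover have "norm (Q x) = L2_set (\<lambda>r. g r * (x \<bullet> w r)) {..<d}"
    unfolding L2_set_def Q_def
    by (simp flip: orthonormal_sum_norm[OF w finite_lessThan])
  ultimately show ?thesis
    using norm_triangle_ineq3[of "P x" "Q x"] by simp
qed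

lemma inverse_sqrt_lipschitz:
  fixes a b \<mu> :: real
  assumes "0 < \<mu>" "\<mu> \<le> a" "\<mu> \<le> b"
  shows "\<bar>1 / sqrt a - 1 / sqrt b\<bar> \<le> 1 / (\<mu> * sqrt \<mu>) * \<bar>a - b\<bar>"
proof -
  have pos: "0 < sqrt \<mu>" "sqrt \<mu> \<le> sqrt a" "sqrt \<mu> \<le> sqrt b" "0 < sqrt a" "0 < sqrt b"
    using assms by auto
  have "1 / sqrt a - 1 / sqrt b =
      (sqrt b - sqrt a) * (sqrt a + sqrt b) / (sqrt a * sqrt b * (sqrt a + sqrt b))"
    using pos add_pos_pos[OF pos(4,5)] by (simp add: diff_frac_eq)
  also have "(sqrt b - sqrt a) * (sqrt a + sqrt b) = b - a"
    using assms by (simp add: algebra_simps)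
  finally have "1 / sqrt a - 1 / sqrt b = (b - a) / (sqrt a * sqrt b * (sqrt a + sqrt b))" .
  then have "\<bar>1 / sqrt a - 1 / sqrt b\<bar> = \<bar>a - b\<bar> / (sqrt a * sqrt b * (sqrt a + sqrt b))"
    using pos by (simp add: abs_mult abs_minus_commute)
  also have "\<dots> \<le> \<bar>a - b\<bar> / (sqrt \<mu> * sqrt \<mu> * sqrt \<mu>)"
  proof (rule divide_left_mono)
    have "sqrt \<mu> \<le> sqrt a + sqrt b"
      using assms by (intro add_increasing2) auto
    from mult_mono[OF mult_mono[OF pos(2,3)] this]
    show "sqrt \<mu> * sqrt \<mu> * sqrt \<mu> \<le> sqrt a * sqrt b * (sqrt a + sqrt b)"
      using assms by simp
    show "0 < (sqrt a * sqrt b * (sqrt a + sqrt b)) * (sqrt \<mu> * sqrt \<mu> * sqrt \<mu>)"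
      using pos by (intro mult_pos_pos add_pos_pos)
  qed simp
  finally show ?thesis
    using assms by simp
qed

text \<open>
  A common Lipschitz constant of the weights \<open>1 / sqrt\<close> above and \<open>0\<close> below a gap: the first
  summand is one for \<open>1 / sqrt\<close> on \<open>{\<mu>..}\<close>, and the second accounts for a jump of at most
  \<open>1 / sqrt \<mu>\<close> between arguments that are at least \<open>c\<close> apart.
\<close>

definition score_lipschitz :: "real \<Rightarrow> real \<Rightarrow> real" where
  "score_lipschitz \<mu> c = 1 / (\<mu> * sqrt \<mu>) + 1 / (c * sqrt \<mu>)"

text \<open>
  The weights on the two spectra are compared across the midpoint of the gap: all leading
  eigenvalues are above it, all others below, and those of \<open>A\<close> have distance at least half the
  gap from it.
\<close>

lemma standardized_score_norm_perturbation:
  fixes A B :: "'h::real_inner \<Rightarrow>\<^sub>L 'h"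
  assumes A: "spectral_decomposition A l v" and B: "spectral_decomposition B m w"
    and hsA: "hilbert_schmidt A" and hsB: "hilbert_schmidt B"
    and l: "decseq l" "\<And>j. 0 \<le> l j" and d: "1 \<le> d" and gap: "l d < l (d - 1)"
    and m: "decreasing_eigenvalues d m"
    and small: "hs_norm (A - B) < (l (d - 1) - l d) / 2"
  shows "\<bar>L2_set (\<lambda>r. (x \<bullet> v r) / sqrt (l r)) {..<d} - L2_set (\<lambda>r. (x \<bullet> w r) / sqrt (m r)) {..<d}\<bar>
    \<le> score_lipschitz ((l (d - 1) + l d) / 2) ((l (d - 1) - l d) / 2) * hs_norm (A - B) * norm x"
proof -
  define \<mu> where "\<mu> = (l (d - 1) + l d) / 2"
  define c where "c = (l (d - 1) - l d) / 2"
  define f where "f i = (if i < d then 1 / sqrt (l i) else 0)" for i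
  define g where "g j = (if j < d then 1 / sqrt (m j) else 0)" for j
  let ?L = "score_lipschitz \<mu> c"
  have sep: "\<mu> < m j \<longleftrightarrow> j < d" for j
    using leading_eigenvalues_separated[OF A B hsA hsB l d gap m small] by (simp add: \<mu>_def)
  have c: "0 < c" "0 < \<mu>" "l d + c = \<mu>" "\<mu> + c = l (d - 1)"
    using gap l(2)[of d] by (auto simp: \<mu>_def c_def field_simps)
  have top: "\<mu> + c \<le> l i" if "i < d" for i
    using that l(1) c by (auto simp: decseq_def)
  have rest: "l i + c \<le> \<mu>" if "\<not> i < d" for i
    using that l(1) c by (auto simp: decseq_def)
  have L: "1 / (\<mu> * sqrt \<mu>) \<le> ?L" "1 / (c * sqrt \<mu>) \<le> ?L" "0 \<le> ?L"
    using c by (simp_all add: score_lipschitz_def)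
  have across: "1 / sqrt a \<le> ?L * t" if "\<mu> \<le> a" "c \<le> t" for a t
  proof -
    have "1 / sqrt a \<le> 1 / sqrt \<mu>"
      using that c by (intro divide_left_mono) auto
    also have "\<dots> = 1 / (c * sqrt \<mu>) * c"
      using c by simp
    also have "\<dots> \<le> ?L * t"
      using that c L by (intro mult_mono) auto
    finally show ?thesis .
  qed
  have lip: "\<bar>f i - g j\<bar> \<le> ?L * \<bar>l i - m j\<bar>" for i j
  proof (cases "i < d"; cases "j < d")
    assume ij: "i < d" "j < d"
    have "\<bar>1 / sqrt (l i) - 1 / sqrt (m j)\<bar> \<le> 1 / (\<mu> * sqrt \<mu>) * \<bar>l i - m j\<bar>"
      using top[OF ij(1)] sep[of j] ij c by (intro inverse_sqrt_lipschitz) auto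
    also have "\<dots> \<le> ?L * \<bar>l i - m j\<bar>"
      by (intro mult_right_mono L) auto
    finally show ?thesis
      using ij by (simp add: f_def g_def)
  next
    assume ij: "i < d" "\<not> j < d"
    then have "1 / sqrt (l i) \<le> ?L * \<bar>l i - m j\<bar>"
      using top[of i] sep[of j] c by (intro across) auto
    then show ?thesis
      using ij l(2) by (simp add: f_def g_def)
  next
    assume ij: "\<not> i < d" "j < d"
    then have "1 / sqrt (m j) \<le> ?L * \<bar>l i - m j\<bar>"
      using rest[of i] sep[of j] by (intro across) auto
    then show ?thesis
      using ij sep[of j] c by (simp add: f_def g_def)
  next
    assume "\<not> i < d" "\<not> j < d"
    then show ?thesis
      using L by (simp add: f_def g_def)
  qed
  have "\<bar>L2_set (\<lambda>r. f r * (x \<bullet> v r)) {..<d} - L2_set (\<lambda>r. g r * (x \<bullet> w r)) {..<d}\<bar>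
      \<le> ?L * hs_norm (A - B) * norm x"
    by (rule weighted_score_norm_perturbation[OF A B hilbert_schmidt_diff[OF hsA hsB] L(3) lip])
      (simp_all add: f_def g_def)
  moreover have "L2_set (\<lambda>r. f r * (x \<bullet> v r)) {..<d} = L2_set (\<lambda>r. (x \<bullet> v r) / sqrt (l r)) {..<d}"
    "L2_set (\<lambda>r. g r * (x \<bullet> w r)) {..<d} = L2_set (\<lambda>r. (x \<bullet> w r) / sqrt (m r)) {..<d}"
    by (intro L2_set_cong; simp add: f_def g_def)+
  ultimately show ?thesis
    by (simp add: \<mu>_def c_def)
qed

section \<open>The change-aligned statistic on a fixed sample\<close>

lemma cusum_inner: "cusum n k x \<bullet> z = cusum n k (\<lambda>i. x i \<bullet> z)"
  by (simp add: cusum_def inner_sum_left inner_diff_left)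

lemma cusum_observation_constant:
  assumes g: "g constant_on {0..1}" and n: "0 < n" and k: "k \<le> n"
  shows "cusum n k (observation g \<Delta> \<epsilon> n \<omega>) = cusum n k (\<lambda>i. \<epsilon> (int i) \<omega>)"
proof -
  obtain a where a: "\<And>t. t \<in> {0..1} \<Longrightarrow> g t = a"
    using g by (auto simp: constant_on_def)
  have obs: "observation g \<Delta> \<epsilon> n \<omega> i = a *\<^sub>R \<Delta> + \<epsilon> (int i) \<omega>" if "i \<le> n" for i
    using that n by (simp add: observation_def a)
  have "(1 / real n) *\<^sub>R (\<Sum>i=1..n. observation g \<Delta> \<epsilon> n \<omega> i) =
      (1 / real n) *\<^sub>R (\<Sum>i=1..n. a *\<^sub>R \<Delta> + \<epsilon> (int i) \<omega>)"
    by (intro arg_cong[where f="scaleR _"] sum.cong) (auto simp: obs)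
  also have "\<dots> = a *\<^sub>R \<Delta> + (1 / real n) *\<^sub>R (\<Sum>i=1..n. \<epsilon> (int i) \<omega>)"
    using n by (simp add: sum.distrib scaleR_right_distrib scaleR_left.sum sum_constant_scaleR)
  finally show ?thesis
    unfolding cusum_def using k
    by (intro arg_cong[where f="scaleR _"] sum.cong) (auto simp: obs)
qed

lemma Max_image_close:
  fixes a b :: "'i \<Rightarrow> real"
  assumes K: "finite K" "K \<noteq> {}" and close: "\<And>k. k \<in> K \<Longrightarrow> \<bar>a k - b k\<bar> \<le> t"
  shows "\<bar>Max (a ` K) - Max (b ` K)\<bar> \<le> t"
proof -
  have le: "Max (a ` K) \<le> Max (b ` K) + t" if "\<And>k. k \<in> K \<Longrightarrow> \<bar>a k - b k\<bar> \<le> t" for a b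
  proof (rule Max.boundedI)
    fix y assume "y \<in> a ` K"
    then obtain k where k: "k \<in> K" "y = a k" by auto
    have "b k \<le> Max (b ` K)" using k K by auto
    then show "y \<le> Max (b ` K) + t" using that[OF k(1)] k by linarith
  qed (use K in auto)
  show ?thesis
    using le[of a b] le[of b a] close by (fastforce simp: abs_minus_commute abs_le_iff)
qed

lemma normalized_close:
  fixes w z :: "'h::real_normed_vector"
  assumes w: "norm w = 1"
  shows "norm ((1 / norm z) *\<^sub>R z - w) \<le> 2 * norm (z - w)"
proof (cases "z = 0")
  case True
  then show ?thesis using w by simp
next
  case False
  have "(1 / norm z) *\<^sub>R z - z = ((1 - norm z) / norm z) *\<^sub>R z"
    using False by (simp add: diff_divide_distrib scaleR_left_diff_distrib)
  then have "norm ((1 / norm z) *\<^sub>R z - z) = \<bar>norm w - norm z\<bar>"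
    using False w by simp
  also have "\<dots> \<le> norm (z - w)"
    by (metis norm_minus_commute norm_triangle_ineq3)
  finally show ?thesis
    using norm_triangle_ineq[of "(1 / norm z) *\<^sub>R z - z" "z - w"] by simp
qed

text \<open>
  Multiplying by \<open>n powr \<gamma>\<close> does not change the normalized vector and shows that it is \<open>w\<close> plus a
  term of size \<open>n powr (\<gamma> - 1/2)\<close> times the norm of the partial sum, so without a change the
  alignment is asymptotically negligible.
\<close>

lemma aligned_close:
  fixes w :: "'h::real_inner"
  assumes w: "norm w = 1" and n: "0 < n"
  shows "norm (aligned n \<gamma> k w x - w) \<le> 2 * (real n powr (\<gamma> - 1/2) * norm (cusum n k x))"
proof -
  define u where "u = (1 / sqrt (real n)) *\<^sub>R cusum n k x"
  define s :: real where "s = (if w \<bullet> u \<ge> 0 then 1 else - 1)"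
  define y where "y = (1 / real n powr \<gamma>) *\<^sub>R w + s *\<^sub>R u"
  define p where "p = real n powr \<gamma>"
  have p: "0 < p" using n by (simp add: p_def)
  have al: "aligned n \<gamma> k w x = (1 / norm y) *\<^sub>R y"
    by (simp add: aligned_def Let_def u_def s_def y_def)
  have "(1 / norm y) *\<^sub>R y = (1 / norm (p *\<^sub>R y)) *\<^sub>R (p *\<^sub>R y)"
    using p by simp
  then have "norm (aligned n \<gamma> k w x - w) \<le> 2 * norm (p *\<^sub>R y - w)"
    unfolding al using normalized_close[OF w, of "p *\<^sub>R y"] by metis
  also have "p *\<^sub>R y - w = (p * s) *\<^sub>R u"
    using p by (simp add: y_def scaleR_right_distrib flip: p_def)
  also have "norm \<dots> = (p / sqrt (real n)) * norm (cusum n k x)"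
    using p by (simp add: u_def s_def abs_mult)
  also have "p / sqrt (real n) = real n powr (\<gamma> - 1/2)"
    using n by (simp add: p_def powr_diff powr_half_sqrt)
  finally show ?thesis .
qed

text \<open>
  The first summand of the bound comes from the alignment, which affects one coordinate only, the
  second one from the estimation of the eigenelements.
\<close>

lemma adjusted_statistic_close:
  fixes A B :: "'h::real_inner \<Rightarrow>\<^sub>L 'h"
  assumes A: "spectral_decomposition A l v" and B: "spectral_decomposition B m w"
    and hsA: "hilbert_schmidt A" and hsB: "hilbert_schmidt B"
    and l: "decseq l" "\<And>j. 0 \<le> l j" and d: "1 \<le> d" and gap: "l d < l (d - 1)"
    and m: "decreasing_eigenvalues d m"
    and small: "hs_norm (A - B) < (l (d - 1) - l d) / 2"
    and n: "2 \<le> n" and k: "k \<in> {1..<n}"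
    and K: "\<And>j. j \<in> {1..<n} \<Longrightarrow> norm (cusum n j x) \<le> K"
  obtains t where "adjusted_statistic n d \<gamma> k m w x = ereal t"
    and "\<bar>t - max_statistic n d l v x\<bar> \<le> 2 * K\<^sup>2 / sqrt ((l (d - 1) + l d) / 2) * real n powr (\<gamma> - 1/2)
      + score_lipschitz ((l (d - 1) + l d) / 2) ((l (d - 1) - l d) / 2) * K * hs_norm (A - B)"
proof -
  define \<mu> where "\<mu> = (l (d - 1) + l d) / 2"
  define L where "L = score_lipschitz \<mu> ((l (d - 1) - l d) / 2)"
  define w' where "w' = w(0 := aligned n \<gamma> k (w 0) x)"
  define \<rho> where "\<rho> = real n powr (\<gamma> - 1/2)"
  have w: "norm (w 0) = 1"
    using B orthonormal_basis_norm by (auto simp: spectral_decomposition_def)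
  have hs0: "0 \<le> hs_norm (A - B)"
    by (intro hs_norm_nonneg hilbert_schmidt_diff hsA hsB)
  have \<mu>: "0 < \<mu>" using gap l(2)[of d] by (simp add: \<mu>_def)
  have L0: "0 \<le> L"
    using \<mu> gap by (simp add: L_def score_lipschitz_def)
  have K0: "0 \<le> K"
    using K[OF k] norm_ge_zero order_trans by blast
  have sep: "\<mu> < m j \<longleftrightarrow> j < d" for j
    using leading_eigenvalues_separated[OF A B hsA hsB l d gap m small] by (simp add: \<mu>_def)
  have al: "norm (w' 0 - w 0) \<le> 2 * (\<rho> * K)"
  proof -
    have "norm (w' 0 - w 0) \<le> 2 * (\<rho> * norm (cusum n k x))"
      unfolding w'_def \<rho>_def using aligned_close[OF w, of n] n by simp
    also have "\<dots> \<le> 2 * (\<rho> * K)"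
      using K[OF k] by (simp add: \<rho>_def mult_left_mono)
    finally show ?thesis .
  qed
  have "\<bar>L2_set (\<lambda>r. cusum n j (\<lambda>i. x i \<bullet> w' r) / sqrt \<bar>m r\<bar>) {..<d} -
      L2_set (\<lambda>r. cusum n j (\<lambda>i. x i \<bullet> v r) / sqrt (l r)) {..<d}\<bar>
      \<le> 2 * K\<^sup>2 / sqrt \<mu> * \<rho> + L * K * hs_norm (A - B)" if j: "j \<in> {1..<n}" for j
  proof -
    define S where "S = cusum n j x"
    have S: "norm S \<le> K" using K[OF j] by (simp add: S_def)
    let ?a = "\<lambda>r. (S \<bullet> w' r) / sqrt \<bar>m r\<bar>" and ?b = "\<lambda>r. (S \<bullet> w r) / sqrt (m r)"
      and ?c = "\<lambda>r. (S \<bullet> v r) / sqrt (l r)"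
    have absm: "\<bar>m r\<bar> = m r" if "r < d" for r
      using sep[of r] that \<mu> by simp
    have diff: "L2_set (\<lambda>r. ?a r - ?b r) {..<d} \<le> 2 * K\<^sup>2 / sqrt \<mu> * \<rho>"
    proof -
      have "L2_set (\<lambda>r. ?a r - ?b r) {..<d} \<le> (\<Sum>r<d. \<bar>?a r - ?b r\<bar>)"
        by (rule L2_set_le_sum_abs)
      also have "\<dots> = (\<Sum>r\<in>{0}. \<bar>?a r - ?b r\<bar>)"
        using d absm by (intro sum.mono_neutral_right) (auto simp: w'_def)
      also have "\<dots> = \<bar>S \<bullet> (w' 0 - w 0)\<bar> / sqrt (m 0)"
        using absm[of 0] d sep[of 0] \<mu> by (simp add: inner_diff_right flip: diff_divide_distrib)
      also have "\<dots> \<le> (K * (2 * (\<rho> * K))) / sqrt \<mu>"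
      proof (rule frac_le)
        have "\<bar>S \<bullet> (w' 0 - w 0)\<bar> \<le> norm S * norm (w' 0 - w 0)"
          by (rule Cauchy_Schwarz_ineq2)
        also have "\<dots> \<le> K * (2 * (\<rho> * K))"
          using S al K0 by (intro mult_mono) auto
        finally show "\<bar>S \<bullet> (w' 0 - w 0)\<bar> \<le> K * (2 * (\<rho> * K))" .
        show "sqrt \<mu> \<le> sqrt (m 0)" "0 < sqrt \<mu>"
          using sep[of 0] d \<mu> by auto
        show "0 \<le> K * (2 * (\<rho> * K))"
          using K0 by (simp add: \<rho>_def)
      qed
      also have "\<dots> = 2 * K\<^sup>2 / sqrt \<mu> * \<rho>"
        by (simp add: power2_eq_square)
      finally show ?thesis .
    qed
    have tri: "L2_set f {..<d} \<le> L2_set g {..<d} + L2_set (\<lambda>r. f r - g r) {..<d}" for f g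
      using L2_set_triangle_ineq[of g "\<lambda>r. f r - g r" "{..<d}"] by simp
    have swap: "L2_set (\<lambda>r. ?b r - ?a r) {..<d} = L2_set (\<lambda>r. ?a r - ?b r) {..<d}"
      by (simp add: L2_set_def power2_commute)
    have "\<bar>L2_set ?a {..<d} - L2_set ?b {..<d}\<bar> \<le> L2_set (\<lambda>r. ?a r - ?b r) {..<d}"
      using tri[of ?a ?b] tri[of ?b ?a] unfolding swap by linarith
    moreover have "\<bar>L2_set ?c {..<d} - L2_set ?b {..<d}\<bar> \<le> L * hs_norm (A - B) * norm S"
      using standardized_score_norm_perturbation[OF A B hsA hsB l d gap m small, of S]
      by (simp add: L_def \<mu>_def)
    moreover have "L * hs_norm (A - B) * norm S \<le> L * K * hs_norm (A - B)"
      using S L0 hs0 mult_left_mono[OF S, of "L * hs_norm (A - B)"] by (simp add: ac_simps)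
    ultimately have "\<bar>L2_set ?a {..<d} - L2_set ?c {..<d}\<bar>
        \<le> 2 * K\<^sup>2 / sqrt \<mu> * \<rho> + L * K * hs_norm (A - B)"
      using diff by linarith
    then show ?thesis
      by (simp add: S_def cusum_inner)
  qed
  then have "\<bar>max_statistic n d (\<lambda>j. \<bar>m j\<bar>) w' x - max_statistic n d l v x\<bar>
      \<le> 2 * K\<^sup>2 / sqrt \<mu> * \<rho> + L * K * hs_norm (A - B)"
    unfolding max_statistic_def using n by (intro Max_image_close) auto
  moreover have "\<not> (\<exists>j<d. m j = 0)"
  proof
    assume "\<exists>j<d. m j = 0"
    then obtain j where "j < d" "m j = 0" by blast
    then show False using sep[of j] \<mu> by simp
  qed
  then have "adjusted_statistic n d \<gamma> k m w x = ereal (max_statistic n d (\<lambda>j. \<bar>m j\<bar>) w' x)"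
    by (simp add: adjusted_statistic_def w'_def)
  ultimately show ?thesis
    using that by (simp add: L_def \<mu>_def \<rho>_def)
qed

section \<open>Convergence in distribution\<close>

text \<open>
  A push-forward never has more than the total mass of \<open>N\<close>: for a map whose push-forward set
  function is not countably additive it is zero by convention.
\<close>

lemma mono_cdf_distr:
  assumes "finite_measure N"
  shows "mono (cdf (distr N borel X))"
proof -
  interpret N: finite_measure N by (rule assms)
  have "emeasure (distr N borel X) A \<le> emeasure N (space N)" for A
    unfolding distr_def emeasure_measure_of_conv by (auto intro: emeasure_space)
  then have "emeasure (distr N borel X) A < top" for A
    using N.emeasure_finite[of "space N"] by (metis le_less_trans less_top)
  then interpret finite_measure "distr N borel X"
    by (intro finite_measureI) (metis infinity_ennreal_def less_irrefl)
  show ?thesis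
    by (intro monoI) (auto simp: cdf_def intro: finite_measure_mono)
qed

text \<open>
  Slutsky's lemma. The closeness is expressed through exceptional events because \<open>X n\<close> may be
  infinite on them. At a continuity point \<open>x\<close> of the limit, the event \<open>X n \<le> x\<close> is enclosed
  between \<open>T n \<le> a\<close> and \<open>T n \<le> b\<close> for continuity points \<open>a < x < b\<close> close to \<open>x\<close>.
\<close>

lemma weak_conv_ereal_slutsky:
  fixes T :: "nat \<Rightarrow> 'a \<Rightarrow> real" and X :: "nat \<Rightarrow> 'a \<Rightarrow> ereal"
  assumes M: "prob_space M" and mono: "mono (cdf L)"
    and T: "\<forall>\<^sub>F n in sequentially. T n \<in> borel_measurable M"
    and X: "\<forall>\<^sub>F n in sequentially. X n \<in> borel_measurable M"
    and conv: "weak_conv_m (\<lambda>n. distr M borel (T n)) L"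
    and close: "\<And>\<delta> \<rho>. 0 < \<delta> \<Longrightarrow> 0 < \<rho> \<Longrightarrow> \<forall>\<^sub>F n in sequentially. \<exists>E\<in>sets M. measure M E < \<rho> \<and>
      (\<forall>\<omega>\<in>space M - E. \<exists>t. X n \<omega> = ereal t \<and> \<bar>t - T n \<omega>\<bar> \<le> \<delta>)"
  shows "weak_conv_ereal M X L"
  unfolding weak_conv_ereal_def
proof (intro conjI X)
  interpret prob_space M by (rule M)
  let ?F = "cdf L"
  have cdf_T: "cdf (distr M borel (T n)) y = measure M {\<omega> \<in> space M. T n \<omega> \<le> y}"
    if "T n \<in> borel_measurable M" for n y
    using that by (auto simp: cdf_def measure_distr intro!: arg_cong[where f="measure M"])
  show "weak_conv (\<lambda>n x. measure M {\<omega> \<in> space M. X n \<omega> \<le> ereal x}) ?F"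
    unfolding weak_conv_def
  proof (intro allI impI)
    fix x assume x: "isCont ?F x"
    show "(\<lambda>n. measure M {\<omega> \<in> space M. X n \<omega> \<le> ereal x}) \<longlonglongrightarrow> ?F x"
    proof (rule tendstoI)
      fix e :: real assume e: "0 < e"
      obtain r where r: "0 < r" "\<And>y. \<bar>y - x\<bar> < r \<Longrightarrow> \<bar>?F y - ?F x\<bar> < e / 3"
        using x e unfolding continuous_at_eps_delta
        by (metis dist_real_def zero_less_divide_iff zero_less_numeral)
      obtain a where a: "x - r < a" "a < x" "isCont ?F a"
        using open_minus_countable[OF mono_ctble_discont[OF mono], of "{x - r<..<x}"] r by auto
      obtain b where b: "x < b" "b < x + r" "isCont ?F b"
        using open_minus_countable[OF mono_ctble_discont[OF mono], of "{x<..<x + r}"] r by auto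
      have "\<bar>?F a - ?F x\<bar> < e / 3" "\<bar>?F b - ?F x\<bar> < e / 3"
        by (rule r(2); use a b in linarith)+
      then have Fab: "?F a > ?F x - e / 3" "?F b < ?F x + e / 3"
        by linarith+
      define \<delta> where "\<delta> = min (x - a) (b - x)"
      have \<delta>: "0 < \<delta>" "a + \<delta> \<le> x" "x + \<delta> \<le> b"
        using a b by (auto simp: \<delta>_def)
      have lim: "(\<lambda>n. cdf (distr M borel (T n)) y) \<longlonglongrightarrow> ?F y" if "isCont ?F y" for y
        using conv that by (simp add: weak_conv_m_def weak_conv_def)
      have "\<forall>\<^sub>F n in sequentially. ?F a - e / 3 < cdf (distr M borel (T n)) a"
        using order_tendstoD(1)[OF lim[OF a(3)], of "?F a - e / 3"] e by simp
      moreover have "\<forall>\<^sub>F n in sequentially. cdf (distr M borel (T n)) b < ?F b + e / 3"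
        using order_tendstoD(2)[OF lim[OF b(3)], of "?F b + e / 3"] e by simp
      moreover have "\<forall>\<^sub>F n in sequentially. \<exists>E\<in>sets M. measure M E < e / 3 \<and>
          (\<forall>\<omega>\<in>space M - E. \<exists>t. X n \<omega> = ereal t \<and> \<bar>t - T n \<omega>\<bar> \<le> \<delta>)"
        using close[OF \<delta>(1), of "e / 3"] e by simp
      ultimately show "\<forall>\<^sub>F n in sequentially.
          dist (measure M {\<omega> \<in> space M. X n \<omega> \<le> ereal x}) (?F x) < e"
        using T X
      proof eventually_elim
        case (elim n)
        note [measurable] = elim(4,5)
        obtain E where [measurable]: "E \<in> sets M" and E: "measure M E < e / 3"
          "\<And>\<omega>. \<omega> \<in> space M - E \<Longrightarrow> \<exists>t. X n \<omega> = ereal t \<and> \<bar>t - T n \<omega>\<bar> \<le> \<delta>"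
          using elim(3) by blast
        let ?X = "{\<omega> \<in> space M. X n \<omega> \<le> ereal x}"
        let ?T = "\<lambda>y. {\<omega> \<in> space M. T n \<omega> \<le> y}"
        have "?X \<subseteq> ?T b \<union> E"
        proof
          fix \<omega> assume w: "\<omega> \<in> ?X"
          show "\<omega> \<in> ?T b \<union> E"
          proof (cases "\<omega> \<in> E")
            case False
            then obtain t where "X n \<omega> = ereal t" "\<bar>t - T n \<omega>\<bar> \<le> \<delta>"
              using E(2)[of \<omega>] w by auto
            then show ?thesis using w \<delta> by auto
          qed simp
        qed
        then have "measure M ?X \<le> measure M (?T b \<union> E)"
          by (rule finite_measure_mono) measurable
        also have "\<dots> \<le> measure M (?T b) + measure M E"
          by (rule measure_Un_le) measurable
        finally have upper: "measure M ?X < ?F x + e"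
          using E(1) elim(2) Fab(2) unfolding cdf_T[OF elim(4)] by linarith
        have "?T a \<subseteq> ?X \<union> E"
        proof
          fix \<omega> assume w: "\<omega> \<in> ?T a"
          show "\<omega> \<in> ?X \<union> E"
          proof (cases "\<omega> \<in> E")
            case False
            then obtain t where "X n \<omega> = ereal t" "\<bar>t - T n \<omega>\<bar> \<le> \<delta>"
              using E(2)[of \<omega>] w by auto
            then show ?thesis using w \<delta> by auto
          qed simp
        qed
        then have "measure M (?T a) \<le> measure M (?X \<union> E)"
          by (rule finite_measure_mono) measurable
        also have "\<dots> \<le> measure M ?X + measure M E"
          by (rule measure_Un_le) measurable
        finally have "?F x - e < measure M ?X"
          using E(1) elim(1) Fab(1) unfolding cdf_T[OF elim(4)] by linarith
        with upper show ?case
          by (simp add: dist_real_def abs_less_iff)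
      qed
    qed
  qed
qed

section \<open>Measurability of the statistics\<close>

text \<open>
  The measure of a non-measurable set is zero by convention, so bounds on the probabilities of
  the exceptional events are meaningful only together with the following facts.
\<close>

lemma borel_measurable_Max_image:
  fixes f :: "'i \<Rightarrow> 'a \<Rightarrow> real"
  assumes "finite K" "K \<noteq> {}" "\<And>k. k \<in> K \<Longrightarrow> f k \<in> borel_measurable M"
  shows "(\<lambda>\<omega>. MAX k\<in>K. f k \<omega>) \<in> borel_measurable M"
  using assms
proof (induction K rule: finite_ne_induct)
  case (insert k K)
  then show ?case by (simp add: borel_measurable_max)
qed simp

lemma borel_measurable_cusum:
  fixes x :: "'a \<Rightarrow> nat \<Rightarrow> 'v::{real_normed_vector, second_countable_topology}"
  assumes "\<And>i. (\<lambda>\<omega>. x \<omega> i) \<in> borel_measurable M"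
  shows "(\<lambda>\<omega>. cusum n k (x \<omega>)) \<in> borel_measurable M"
  unfolding cusum_def
  by (intro borel_measurable_scaleR borel_measurable_sum borel_measurable_diff
      borel_measurable_const assms)

lemma borel_measurable_max_statistic:
  fixes x v :: "'a \<Rightarrow> nat \<Rightarrow> 'h::{real_inner, second_countable_topology}"
  assumes n: "2 \<le> n" and x[measurable]: "\<And>i. (\<lambda>\<omega>. x \<omega> i) \<in> borel_measurable M"
    and v: "\<And>r. r < d \<Longrightarrow> (\<lambda>\<omega>. v \<omega> r) \<in> borel_measurable M"
    and l: "\<And>r. r < d \<Longrightarrow> (\<lambda>\<omega>. l \<omega> r) \<in> borel_measurable M"
  shows "(\<lambda>\<omega>. max_statistic n d (l \<omega>) (v \<omega>) (x \<omega>)) \<in> borel_measurable M"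
  unfolding max_statistic_def
proof (rule borel_measurable_Max_image)
  fix k
  have "(\<lambda>\<omega>. cusum n k (x \<omega>) \<bullet> v \<omega> r / sqrt (l \<omega> r)) \<in> borel_measurable M" if "r < d" for r
    using v[OF that] l[OF that] borel_measurable_cusum[OF x] by measurable
  then have "(\<lambda>\<omega>. \<Sum>r<d. (cusum n k (x \<omega>) \<bullet> v \<omega> r / sqrt (l \<omega> r))\<^sup>2) \<in> borel_measurable M"
    by (intro borel_measurable_sum borel_measurable_power) auto
  then show "(\<lambda>\<omega>. L2_set (\<lambda>r. cusum n k (\<lambda>i. x \<omega> i \<bullet> v \<omega> r) / sqrt (l \<omega> r)) {..<d})
      \<in> borel_measurable M"
    unfolding L2_set_def cusum_inner by measurable
qed (use n in auto)

lemma borel_measurable_aligned: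
  fixes x :: "'a \<Rightarrow> nat \<Rightarrow> 'h::{real_inner, second_countable_topology}"
  assumes x: "\<And>i. (\<lambda>\<omega>. x \<omega> i) \<in> borel_measurable M"
    and [measurable]: "w \<in> borel_measurable M"
    and k: "k \<in> measurable M (count_space UNIV)"
  shows "(\<lambda>\<omega>. aligned n \<gamma> (k \<omega>) (w \<omega>) (x \<omega>)) \<in> borel_measurable M"
proof -
  have [measurable]: "(\<lambda>\<omega>. cusum n (k \<omega>) (x \<omega>)) \<in> borel_measurable M"
    by (rule measurable_compose_countable[OF borel_measurable_cusum[OF x] k])
  show ?thesis
    unfolding aligned_def Let_def by measurable
qed

lemma borel_measurable_adjusted_statistic:
  fixes x w :: "'a \<Rightarrow> nat \<Rightarrow> 'h::{real_inner, second_countable_topology}"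
  assumes n: "2 \<le> n" and x: "\<And>i. (\<lambda>\<omega>. x \<omega> i) \<in> borel_measurable M"
    and w: "\<And>r. r < d \<Longrightarrow> (\<lambda>\<omega>. w \<omega> r) \<in> borel_measurable M"
    and l: "\<And>r. r < d \<Longrightarrow> (\<lambda>\<omega>. l \<omega> r) \<in> borel_measurable M"
    and k: "k \<in> measurable M (count_space UNIV)"
  shows "(\<lambda>\<omega>. adjusted_statistic n d \<gamma> (k \<omega>) (l \<omega>) (w \<omega>) (x \<omega>)) \<in> borel_measurable M"
proof -
  have "(\<lambda>\<omega>. ((w \<omega>)(0 := aligned n \<gamma> (k \<omega>) (w \<omega> 0) (x \<omega>))) r) \<in> borel_measurable M"
    if "r < d" for r
    using that w[of r] w[of 0] by (cases "r = 0") (auto intro!: borel_measurable_aligned x k)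
  then have stat: "(\<lambda>\<omega>. max_statistic n d (\<lambda>j. \<bar>l \<omega> j\<bar>)
      ((w \<omega>)(0 := aligned n \<gamma> (k \<omega>) (w \<omega> 0) (x \<omega>))) (x \<omega>)) \<in> borel_measurable M"
    using l by (intro borel_measurable_max_statistic n x) auto
  have "{\<omega> \<in> space M. l \<omega> j = 0} \<in> sets M" if "j \<in> {..<d}" for j
  proof -
    have [measurable]: "(\<lambda>\<omega>. l \<omega> j) \<in> borel_measurable M"
      using l that by simp
    show ?thesis by measurable
  qed
  then have "{\<omega> \<in> space M. \<exists>j\<in>{..<d}. l \<omega> j = 0} \<in> sets M"
    by (intro sets.sets_Collect_finite_Ex) auto
  then have "{\<omega> \<in> space M. \<exists>j<d. l \<omega> j = 0} \<in> sets M"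
    unfolding Bex_def lessThan_iff .
  then show ?thesis
    unfolding adjusted_statistic_def
    by (rule measurable_If[OF borel_measurable_const borel_measurable_ereal[OF stat]])
qed

lemma borel_measurable_hs_norm_diff:
  fixes A :: "'h::{real_inner,banach,second_countable_topology} \<Rightarrow>\<^sub>L 'h"
  assumes [measurable]: "\<And>z. (\<lambda>\<omega>. blinfun_apply (B \<omega>) z) \<in> borel_measurable M"
  shows "(\<lambda>\<omega>. hs_norm (A - B \<omega>)) \<in> borel_measurable M"
  unfolding hs_norm_def Let_def blinfun.diff_left by measurable

section \<open>The limit distribution of the adjusted statistic\<close>

theorem corollary5p1:
  fixes M :: "'a measure"
    and N :: "'b measure"
    and \<epsilon> :: "int \<Rightarrow> 'a \<Rightarrow> 'h::{real_inner,banach,second_countable_topology}"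
    and g :: "real \<Rightarrow> real"
    and \<Delta> :: 'h
    and d :: nat
    and \<gamma> :: real
    and l :: "nat \<Rightarrow> real"
    and v :: "nat \<Rightarrow> 'h"
    and Chat :: "nat \<Rightarrow> 'a \<Rightarrow> 'h \<Rightarrow>\<^sub>L 'h"
    and lhat :: "nat \<Rightarrow> 'a \<Rightarrow> nat \<Rightarrow> real"
    and vhat :: "nat \<Rightarrow> 'a \<Rightarrow> nat \<Rightarrow> 'h"
    and khat :: "nat \<Rightarrow> 'a \<Rightarrow> nat"
    and B :: "nat \<Rightarrow> real \<Rightarrow> 'b \<Rightarrow> real"
  assumes inf_dim: "infinite_dimensional TYPE('h)"
    and prob: "prob_space M"
    \<comment> \<open>signal plus noise model\<close>
    and stationary: "strictly_stationary M \<epsilon>"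
    and square_integrable: "integrable M (\<lambda>\<omega>. (norm (\<epsilon> 1 \<omega>))\<^sup>2)"
    and centered: "\<And>i. (\<integral>\<omega>. \<epsilon> i \<omega> \<partial>M) = 0"
    and g: "piecewise_lipschitz g"
    and \<Delta>: "norm \<Delta> = 1"
    \<comment> \<open>long run covariance operator and its eigenelements\<close>
    and autocov_hs: "\<And>h. hilbert_schmidt (autocov M \<epsilon> h)"
    and autocov_summable: "(\<lambda>h. hs_norm (autocov M \<epsilon> h)) summable_on UNIV"
    and spectral: "spectral_decomposition (long_run_cov M \<epsilon>) l v"
    and l_decreasing: "decseq l"
    and l_nonneg: "\<And>j. 0 \<le> l j"
    and d: "1 \<le> d"
    and l_pos: "0 < l (d - 1)"
    and \<gamma>: "0 < \<gamma>" "\<gamma> < 1/2"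
    \<comment> \<open>estimates of the long run covariance operator and their eigenelements\<close>
    and Chat_measurable: "\<And>n z. 2 \<le> n \<Longrightarrow> (\<lambda>\<omega>. blinfun_apply (Chat n \<omega>) z) \<in> borel_measurable M"
    and Chat_self_adjoint: "\<And>n \<omega>. 2 \<le> n \<Longrightarrow> \<omega> \<in> space M \<Longrightarrow> self_adjoint (Chat n \<omega>)"
    and Chat_hs: "\<And>n \<omega>. 2 \<le> n \<Longrightarrow> \<omega> \<in> space M \<Longrightarrow> hilbert_schmidt (Chat n \<omega>)"
    and Chat_spectral:
      "\<And>n \<omega>. 2 \<le> n \<Longrightarrow> \<omega> \<in> space M \<Longrightarrow> spectral_decomposition (Chat n \<omega>) (lhat n \<omega>) (vhat n \<omega>)"
    and lhat_decreasing:
      "\<And>n \<omega>. 2 \<le> n \<Longrightarrow> \<omega> \<in> space M \<Longrightarrow> decreasing_eigenvalues d (lhat n \<omega>)"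
    and lhat_measurable: "\<And>n j. 2 \<le> n \<Longrightarrow> j < d \<Longrightarrow> (\<lambda>\<omega>. lhat n \<omega> j) \<in> borel_measurable M"
    and vhat_measurable: "\<And>n j. 2 \<le> n \<Longrightarrow> j < d \<Longrightarrow> (\<lambda>\<omega>. vhat n \<omega> j) \<in> borel_measurable M"
    \<comment> \<open>estimate of the change point\<close>
    and khat_measurable: "\<And>n. 2 \<le> n \<Longrightarrow> khat n \<in> measurable M (count_space UNIV)"
    and khat_range: "\<And>n \<omega>. 2 \<le> n \<Longrightarrow> \<omega> \<in> space M \<Longrightarrow> khat n \<omega> \<in> {1..<n}"
    and khat_maximizes:
      "\<And>n \<omega>. 2 \<le> n \<Longrightarrow> \<omega> \<in> space M \<Longrightarrow>
         norm (cusum n (khat n \<omega>) (observation g \<Delta> \<epsilon> n \<omega>)) =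
         (MAX k\<in>{1..<n}. norm (cusum n k (observation g \<Delta> \<epsilon> n \<omega>)))"
    and bridges: "independent_brownian_bridges N d B"
    and i: "o_P_one M (\<lambda>n \<omega>. hs_norm (long_run_cov M \<epsilon> - Chat n \<omega>))"
    and ii: "l (d - 1) > l d"
    and iii: "g constant_on {0..1} \<Longrightarrow>
      weak_conv_m (\<lambda>n. distr M borel (\<lambda>\<omega>. max_statistic n d l v (observation g \<Delta> \<epsilon> n \<omega>)))
        (distr N borel (sup_bridges d B))"
    and iv: "O_P_one M (\<lambda>n \<omega>. MAX k\<in>{1..<n}. norm (cusum n k (\<lambda>i. \<epsilon> (int i) \<omega>)))"
  shows "g constant_on {0..1} \<Longrightarrow>
      weak_conv_ereal M
        (\<lambda>n \<omega>. adjusted_statistic n d \<gamma> (khat n \<omega>) (lhat n \<omega>) (vhat n \<omega>) (observation g \<Delta> \<epsilon> n \<omega>))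
        (distr N borel (sup_bridges d B))"
proof -
  assume const: "g constant_on {0..1}"
  interpret prob_space M by (rule prob)
  define A where "A = long_run_cov M \<epsilon>"
  define Y where "Y n \<omega> = (MAX k\<in>{1..<n}. norm (cusum n k (\<lambda>i. \<epsilon> (int i) \<omega>)))" for n \<omega>
  define H where "H n \<omega> = hs_norm (A - Chat n \<omega>)" for n \<omega>
  define T where "T n \<omega> = max_statistic n d l v (observation g \<Delta> \<epsilon> n \<omega>)" for n \<omega>
  define X where "X n \<omega> = adjusted_statistic n d \<gamma> (khat n \<omega>) (lhat n \<omega>) (vhat n \<omega>)
    (observation g \<Delta> \<epsilon> n \<omega>)" for n \<omega>
  have \<epsilon>: "\<epsilon> i \<in> borel_measurable M" for i
    using stationary by (simp add: strictly_stationary_def)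
  then have obs: "(\<lambda>\<omega>. observation g \<Delta> \<epsilon> n \<omega> i) \<in> borel_measurable M" for n i
    unfolding observation_def by measurable
  have v: "orthonormal_basis v" and A: "spectral_decomposition A l v"
    using spectral by (auto simp: spectral_decomposition_def A_def)
  have hsA: "hilbert_schmidt A"
    unfolding A_def long_run_cov_def
    by (rule hilbert_schmidt_infsum[OF autocov_hs autocov_summable v])
  have T_meas: "T n \<in> borel_measurable M" if "2 \<le> n" for n
    unfolding T_def by (rule borel_measurable_max_statistic[OF that obs]) auto
  have X_meas: "X n \<in> borel_measurable M" if "2 \<le> n" for n
    unfolding X_def using that
    by (intro borel_measurable_adjusted_statistic obs vhat_measurable lhat_measurable
        khat_measurable)
  have "(\<lambda>\<omega>. cusum n k (\<lambda>i. \<epsilon> (int i) \<omega>)) \<in> borel_measurable M" for n k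
    by (rule borel_measurable_cusum[OF \<epsilon>])
  then have Y_meas: "Y n \<in> borel_measurable M" if "2 \<le> n" for n
    unfolding Y_def using that by (intro borel_measurable_Max_image) auto
  have H_meas: "H n \<in> borel_measurable M" if "2 \<le> n" for n
    unfolding H_def by (rule borel_measurable_hs_norm_diff[OF Chat_measurable[OF that]])
  have "weak_conv_ereal M X (distr N borel (sup_bridges d B))"
  proof (rule weak_conv_ereal_slutsky[OF prob])
    show "mono (cdf (distr N borel (sup_bridges d B)))"
      using bridges
      by (intro mono_cdf_distr) (auto simp: independent_brownian_bridges_def prob_space_def)
    show "\<forall>\<^sub>F n in sequentially. T n \<in> borel_measurable M"
      by (rule eventually_mono[OF eventually_ge_at_top[of 2] T_meas])
    show "\<forall>\<^sub>F n in sequentially. X n \<in> borel_measurable M"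
      by (rule eventually_mono[OF eventually_ge_at_top[of 2] X_meas])
    show "weak_conv_m (\<lambda>n. distr M borel (T n)) (distr N borel (sup_bridges d B))"
      using iii[OF const] unfolding T_def .
  next
    fix \<delta> \<rho> :: real assume "0 < \<delta>" "0 < \<rho>"
    define \<mu> where "\<mu> = (l (d - 1) + l d) / 2"
    define c where "c = (l (d - 1) - l d) / 2"
    define L where "L = score_lipschitz \<mu> c"
    have "0 < \<mu>" "0 < c"
      using ii l_pos l_nonneg[of d] by (auto simp: \<mu>_def c_def)
    then have "0 \<le> L"
      by (simp add: L_def score_lipschitz_def)
    obtain K where K: "\<forall>\<^sub>F n in sequentially. measure M {\<omega> \<in> space M. K < \<bar>Y n \<omega>\<bar>} < \<rho> / 2"
      using iv \<open>0 < \<rho>\<close> unfolding O_P_one_def Y_def by (meson half_gt_zero)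
    \<comment> \<open>\<open>K\<close> could be negative, if its exceptional event is the whole space\<close>
    define \<eta> where "\<eta> = min (c / 2) (\<delta> / 2 / (L * \<bar>K\<bar> + 1))"
    have pos: "0 < L * \<bar>K\<bar> + 1"
      using \<open>0 \<le> L\<close> by (simp add: add_nonneg_pos)
    then have "0 < \<eta>"
      using \<open>0 < c\<close> \<open>0 < \<delta>\<close> by (simp add: \<eta>_def)
    \<comment> \<open>the denominator is increased by one, so that the bound also holds for \<open>K = 0\<close>\<close>
    have "L * \<bar>K\<bar> * \<eta> \<le> (L * \<bar>K\<bar> + 1) * (\<delta> / 2 / (L * \<bar>K\<bar> + 1))"
      using \<open>0 \<le> L\<close> \<open>0 < \<eta>\<close> pos by (intro mult_mono) (auto simp: \<eta>_def)
    also have "\<dots> = \<delta> / 2"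
      using pos by (metis less_irrefl nonzero_mult_div_cancel_left times_divide_eq_right)
    finally have \<eta>_bound: "L * \<bar>K\<bar> * \<eta> \<le> \<delta> / 2" .
    have "(\<lambda>n. measure M {\<omega> \<in> space M. \<eta> < \<bar>H n \<omega>\<bar>}) \<longlonglongrightarrow> 0"
      using i \<open>0 < \<eta>\<close> by (simp add: o_P_one_def H_def A_def)
    then have H_small: "\<forall>\<^sub>F n in sequentially. measure M {\<omega> \<in> space M. \<eta> < \<bar>H n \<omega>\<bar>} < \<rho> / 2"
      using \<open>0 < \<rho>\<close> by (intro order_tendstoD(2)) auto
    have "(\<lambda>n. real n powr (\<gamma> - 1/2)) \<longlonglongrightarrow> 0"
      using \<gamma> by (intro tendsto_neg_powr filterlim_real_sequentially) auto
    then have "(\<lambda>n. 2 * \<bar>K\<bar>\<^sup>2 / sqrt \<mu> * real n powr (\<gamma> - 1/2)) \<longlonglongrightarrow> 0"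
      by (rule tendsto_mult_right_zero)
    then have align: "\<forall>\<^sub>F n in sequentially. 2 * \<bar>K\<bar>\<^sup>2 / sqrt \<mu> * real n powr (\<gamma> - 1/2) < \<delta> / 2"
      using \<open>0 < \<delta>\<close> by (intro order_tendstoD(2)) auto
    show "\<forall>\<^sub>F n in sequentially. \<exists>E\<in>sets M. measure M E < \<rho> \<and>
        (\<forall>\<omega>\<in>space M - E. \<exists>t. X n \<omega> = ereal t \<and> \<bar>t - T n \<omega>\<bar> \<le> \<delta>)"
      using K H_small align eventually_ge_at_top[of 2]
    proof eventually_elim
      case (elim n)
      note n = elim(4)
      note [measurable] = Y_meas[OF n] H_meas[OF n]
      let ?E = "{\<omega> \<in> space M. K < \<bar>Y n \<omega>\<bar>} \<union> {\<omega> \<in> space M. \<eta> < \<bar>H n \<omega>\<bar>}"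
      have "measure M ?E \<le>
          measure M {\<omega> \<in> space M. K < \<bar>Y n \<omega>\<bar>} + measure M {\<omega> \<in> space M. \<eta> < \<bar>H n \<omega>\<bar>}"
        by (rule measure_Un_le) measurable
      then have "measure M ?E < \<rho>"
        using elim(1,2) by linarith
      moreover have "\<exists>t. X n \<omega> = ereal t \<and> \<bar>t - T n \<omega>\<bar> \<le> \<delta>" if "\<omega> \<in> space M - ?E" for \<omega>
      proof -
        have \<omega>: "\<omega> \<in> space M" "\<bar>Y n \<omega>\<bar> \<le> K" "\<bar>H n \<omega>\<bar> \<le> \<eta>"
          using that by auto
        have bound: "norm (cusum n j (observation g \<Delta> \<epsilon> n \<omega>)) \<le> \<bar>K\<bar>" if j: "j \<in> {1..<n}" for j
        proof -
          have "norm (cusum n j (observation g \<Delta> \<epsilon> n \<omega>)) = norm (cusum n j (\<lambda>i. \<epsilon> (int i) \<omega>))"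
            using j by (subst cusum_observation_constant[OF const]) auto
          also have "\<dots> \<le> Y n \<omega>"
            unfolding Y_def using j by (intro Max_ge) auto
          finally show ?thesis using \<omega>(2) by linarith
        qed
        have "\<eta> < c"
          using \<open>0 < c\<close> by (simp add: \<eta>_def min_less_iff_disj)
        then have "hs_norm (A - Chat n \<omega>) < (l (d - 1) - l d) / 2"
          using \<omega>(3) unfolding H_def c_def by linarith
        then obtain t where t: "X n \<omega> = ereal t"
          "\<bar>t - T n \<omega>\<bar> \<le> 2 * \<bar>K\<bar>\<^sup>2 / sqrt \<mu> * real n powr (\<gamma> - 1/2) + L * \<bar>K\<bar> * H n \<omega>"
          using adjusted_statistic_close[OF A Chat_spectral[OF n \<omega>(1)] hsA Chat_hs[OF n \<omega>(1)]
              l_decreasing l_nonneg d ii lhat_decreasing[OF n \<omega>(1)] _ n khat_range[OF n \<omega>(1)] bound]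
          unfolding X_def T_def H_def L_def \<mu>_def c_def by metis
        have "L * \<bar>K\<bar> * H n \<omega> \<le> L * \<bar>K\<bar> * \<eta>"
          using \<omega>(3) \<open>0 \<le> L\<close> by (intro mult_left_mono) auto
        then show ?thesis
          using t elim(3) \<eta>_bound by (intro exI[of _ t]) auto
      qed
      ultimately show ?case
        by (intro bexI[of _ ?E]) (auto simp del: Un_iff)
    qed
  qed
  then show ?thesis
    unfolding X_def .
qed

end
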